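(* Consider any of the three picking systems Pcart-N, Pcart, Robot. Let $O_1,O_2,\ldots$ be i.i.d. random orders, and let the arrival times $R_1\le R_2\le\ldots$ form a homogeneous Poisson process with rate $\lambda>0$ (i.e. $R_n=\sum_{j=1}^n X_j$ with $X_j$ i.i.d. exponential with mean $1/\lambda$), independent of the orders. In the case of Robot assume in addition that $\mathbb{E}[K_1]>1$, where $K_1$ is the number of picking locations of $O_1$. Let $I(n)^{rand}$ be the random instance with orders $(O_1,\ldots,O_n)$ and arrival times $(R_1,\ldots,R_n)$, and let $Q^{Reopt}(I(n)^{rand})$ be the set of pending orders at time $R_n$ in instance $I(n)^{rand}$ under policy Reopt. If $$\lim_{n\to\infty}\frac{|Q^{Reopt}(I(n)^{rand})|}{n}=0\quad\text{almost surely,}$$ then $$\lim_{n\to\infty}\frac{Reopt(I(n)^{rand})}{CIOPT(I(n)^{rand})}=1\quad\text{almost surely.}$$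
   Context: Warehouse. A warehouse is a rectilinear grid of length $L$ and width $W$ consisting of $a\ge 1$ equidistant parallel (vertical) aisles, each a segment of length $W$, and $b\ge 2$ equidistant (horizontal) cross-aisles, each a segment of length $L$; the outermost aisles and cross-aisles form the border of the grid (for $a=1$, $L=0$). The picker moves along aisles and cross-aisles at unit speed (and may wait); $d$ is the resulting shortest-path metric. The depot $l_d$ is a fixed point of the grid. Picking locations are points in aisles. The infrastructure ($W,L,a,b,l_d$ and the batching capacity $c\in\mathbb{N}$) is fixed. Instance. An instance $I$ consists of the infrastructure, a sequence of orders $o_1,\ldots,o_n$, where $o_j=\{s_j^1,\ldots,s_j^{k(j)}\}$ is a set of $k(j)\ge1$ picking locations (items), and arrival times $0\le r_1\le\ldots\le r_n$. The picker starts at $l_d$ at time 0. A solution partitions the orders into batches of at most $c$ orders, sequences the batches, and fixes for each batch a visiting sequence of all picking locations of its orders. Batches are processed one after another; an item of $o_j$ cannot be picked before $r_j$; picking itself takes zero time; an order cannot be split between batches. With a pushcart, every batch starts at the depot and ends with the picker's return to the depot, and the objective (total completion time) is the time of the final return to the depot. With a robot, the picker starts the next batch from the location where she picked the last item of the previous batch (a new empty robot is immediately available there), and the objective is the time at which the last item is picked. $CIOPT(I)$ is the minimum objective value when the whole instance is known in advance (the picker may then move towards locations of orders that have not arrived yet). Online policy Reopt and the three systems. Online, the number of orders is unknown and each order (with its picking locations) becomes known only at its arrival time. Reopt never anticipates future orders; when it reoptimizes at time $t$, it computes a plan with minimal total completion time for the orders that have arrived by $t$ and have not been completely picked, treating them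 as immediately available, and follows this plan until the next reoptimization; if there is nothing left to do, the picker stays where she is (at the depot initially and in the pushcart systems). - Pcart-N (pushcart, non-interventionist Reopt): reoptimization takes place only when the picker is at the depot (on each return to the depot if new orders have arrived, or on arrival of an order while she is idle at the depot); started batches cannot be modified. - Pcart (pushcart, interventionist Reopt) and Robot (robot, interventionist Reopt): reoptimization takes place at every order arrival; the plan starts from the picker's current position, orders having at least one item already in the current cart must be completed as part of the current batch, and all other bins of the current cart (of $c$ bins, one order per bin) can be freely (re)assigned to not yet commenced orders. Ties between optimal plans are broken by an arbitrary fixed deterministic rule. $Reopt(I)$ is the resulting total completion time (pushcart or robot objective according to the system), and $CIOPT(I)$ is taken for the same cart type. Stochastic conventions. A random order is $O_j=(K_j,S_j^1,\ldots,S_j^{K_j})$ with $K_j$ the number of its (distinct) picking locations $S_j^1,\ldots,S_j^{K_j}$; locations within the same order may be arbitrarily dependent. Distinct orders are i.i.d. An order is pending at a time if it has arrived by that time but has not yet been picked. $Reopt(\cdot)$ and $CIOPT(\cdot)$ are regarded as measurable functions of the random instance. *)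

theory Defs
  imports "HOL-Probability.Probability"
begin

section \<open>The warehouse\<close>

type_synonym point = "real \<times> real"

record warehouse =
  wh_length :: real
  wh_width :: real
  n_aisles :: nat
  n_cross :: nat
  depot :: point
  capacity :: nat

text \<open>For a single aisle the divisor \<open>n_aisles w - 1\<close> is zero, and the aisle lies at abscissa \<open>0\<close>.\<close>

definition aisles :: "warehouse \<Rightarrow> point set" where
  "aisles w = (\<Union>i<n_aisles w.
     {real i * wh_length w / real (n_aisles w - 1)} \<times> {0..wh_width w})"

definition cross_aisles :: "warehouse \<Rightarrow> point set" where
  "cross_aisles w = (\<Union>i<n_cross w.
     {0..wh_length w} \<times> {real i * wh_width w / real (n_cross w - 1)})"

definition grid :: "warehouse \<Rightarrow> point set" where
  "grid w = aisles w \<union> cross_aisles w"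

definition valid_warehouse :: "warehouse \<Rightarrow> bool" where
  "valid_warehouse w \<longleftrightarrow>
     1 \<le> n_aisles w \<and> 2 \<le> n_cross w \<and> 1 \<le> capacity w \<and> 0 < wh_width w \<and>
     (if n_aisles w = 1 then wh_length w = 0 else 0 < wh_length w) \<and>
     depot w \<in> grid w"

text \<open>
  A picker who moves inside the grid with speed at most one (she may wait) traces a curve
  that is 1-Lipschitz in time. The shortest-path distance is the least time
  she needs to get from one point to the other.
\<close>

definition gdist :: "warehouse \<Rightarrow> point \<Rightarrow> point \<Rightarrow> real" where
  "gdist w p q = Inf {T. 0 \<le> T \<and>
     (\<exists>\<gamma>. 1-lipschitz_on {0..T} \<gamma> \<and> \<gamma> ` {0..T} \<subseteq> grid w \<and> \<gamma> 0 = p \<and> \<gamma> T = q)}"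


section \<open>Instances and batchings\<close>

text \<open>
  An instance lists the orders (sets of picking locations) with their arrival times, in the order
  of arrival. Orders are referred to by their position in this list, starting with \<open>0\<close>;
  an item is an order together with one of its locations.
\<close>

type_synonym inst = "(point set \<times> real) list"
type_synonym item = "nat \<times> point"

definition valid_inst :: "warehouse \<Rightarrow> inst \<Rightarrow> bool" where
  "valid_inst w I \<longleftrightarrow>
     (\<forall>(ord, r) \<in> set I. finite ord \<and> ord \<noteq> {} \<and> ord \<subseteq> aisles w \<and> 0 \<le> r) \<and> sorted (map snd I)"

definition items :: "inst \<Rightarrow> item set" where
  "items I = {(j, s). j < length I \<and> s \<in> fst (I ! j)}"

definition known :: "inst \<Rightarrow> real \<Rightarrow> inst" where
  "known I t = takeWhile (\<lambda>(ord, r). r \<le> t) I"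

abbreviation orders_of :: "item list \<Rightarrow> nat set" where
  "orders_of b \<equiv> fst ` set b"

text \<open>
  \<open>batching c X C bs\<close>: the sequence of batches \<open>bs\<close>, each given by the visiting sequence of its
  items, picks exactly the items of \<open>X\<close>, where the first batch continues a cart in which the
  orders \<open>C\<close> (picked completely or in part) already occupy bins. The first batch may add no
  further item to a nonempty cart. Offline solutions are the case \<open>C = {}\<close>.
\<close>

definition batching :: "nat \<Rightarrow> item set \<Rightarrow> nat set \<Rightarrow> item list list \<Rightarrow> bool" where
  "batching c X C bs \<longleftrightarrow>
     bs \<noteq> [] \<and> distinct (concat bs) \<and> set (concat bs) = X \<and>
     (\<forall>i<length bs. \<forall>k<length bs. i \<noteq> k \<longrightarrow> orders_of (bs ! i) \<inter> orders_of (bs ! k) = {}) \<and>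
     card (C \<union> orders_of (hd bs)) \<le> c \<and>
     (\<forall>b \<in> set (tl bs). b \<noteq> [] \<and> card (orders_of b) \<le> c \<and> orders_of b \<inter> C = {}) \<and>
     (C = {} \<and> X \<noteq> {} \<longrightarrow> hd bs \<noteq> [])"


section \<open>Schedules and the offline optimum\<close>

datatype system = PcartN | Pcart | Robot

datatype stop = Pick nat point | Finish

definition stops :: "item list list \<Rightarrow> stop list" where
  "stops bs = concat (map (\<lambda>b. map (\<lambda>(j, s). Pick j s) b @ [Finish]) bs)"

text \<open>
  Times and places at which a picker, starting at time \<open>t\<close> in \<open>p\<close>, performs the given stops
  as early as possible if order \<open>j\<close> is released at time \<open>r j\<close>. A batch is finished by
  returning to the depot with a pushcart, and on the spot with a robot.
\<close>

fun schedule :: "system \<Rightarrow> warehouse \<Rightarrow> (nat \<Rightarrow> real) \<Rightarrow> real \<Rightarrow> point \<Rightarrow> stop list \<Rightarrow>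
    (stop \<times> real \<times> point) list" where
  "schedule sys w r t p [] = []"
| "schedule sys w r t p (Pick j s # xs) =
     (let u = max (t + gdist w p s) (r j) in (Pick j s, u, s) # schedule sys w r u s xs)"
| "schedule sys w r t p (Finish # xs) =
     (let q = (if sys = Robot then p else depot w); u = t + gdist w p q
      in (Finish, u, q) # schedule sys w r u q xs)"

definition completion :: "system \<Rightarrow> warehouse \<Rightarrow> (nat \<Rightarrow> real) \<Rightarrow> real \<Rightarrow> point \<Rightarrow>
    item list list \<Rightarrow> real" where
  "completion sys w r t p bs = last (t # map (fst \<circ> snd) (schedule sys w r t p (stops bs)))"

text \<open>The infimum ranges over a finite nonempty set if the instance is valid.\<close>

definition ciopt :: "system \<Rightarrow> warehouse \<Rightarrow> inst \<Rightarrow> real" where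
  "ciopt sys w I =
     (INF bs \<in> {bs. batching (capacity w) (items I) {} bs}.
        completion sys w (\<lambda>j. snd (I ! j)) 0 (depot w) bs)"


section \<open>Reoptimization\<close>

text \<open>
  \<open>cart\<close> contains the orders with an item in the current cart, \<open>picked\<close> maps the
  items picked so far to their picking times.
\<close>

record state =
  clock :: real
  position :: point
  cart :: "nat set"
  picked :: "item \<rightharpoonup> real"

text \<open>
  Shortest paths in the grid are not unique and an interrupted picker may be anywhere on her way.
  Hence a plan also fixes the position \<open>path p u\<close> at each (absolute) time \<open>u\<close>.
\<close>

record plan =
  batches :: "item list list"
  path :: "real \<Rightarrow> point"

definition plan_schedule :: "system \<Rightarrow> warehouse \<Rightarrow> state \<Rightarrow> item list list \<Rightarrow>
    (stop \<times> real \<times> point) list" where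
  "plan_schedule sys w s bs =
     schedule sys w (\<lambda>_. clock s) (clock s) (position s) (stops bs)"

definition plan_completion :: "system \<Rightarrow> warehouse \<Rightarrow> state \<Rightarrow> item list list \<Rightarrow> real" where
  "plan_completion sys w s bs =
     completion sys w (\<lambda>_. clock s) (clock s) (position s) bs"

definition feasible_batches :: "warehouse \<Rightarrow> inst \<Rightarrow> state \<Rightarrow> item list list \<Rightarrow> bool" where
  "feasible_batches w K s bs \<longleftrightarrow> batching (capacity w) (items K - dom (picked s)) (cart s) bs"

definition follows :: "system \<Rightarrow> warehouse \<Rightarrow> state \<Rightarrow> plan \<Rightarrow> bool" where
  "follows sys w s \<pi> \<longleftrightarrow>
     1-lipschitz_on {clock s..} (path \<pi>) \<and> path \<pi> ` {clock s..} \<subseteq> grid w \<and>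
     path \<pi> (clock s) = position s \<and>
     (\<forall>(x, u, q) \<in> set (plan_schedule sys w s (batches \<pi>)). path \<pi> u = q) \<and>
     (let e = plan_completion sys w s (batches \<pi>) in \<forall>u\<ge>e. path \<pi> u = path \<pi> e)"

definition optimal_plan :: "system \<Rightarrow> warehouse \<Rightarrow> inst \<Rightarrow> state \<Rightarrow> plan \<Rightarrow> bool" where
  "optimal_plan sys w K s \<pi> \<longleftrightarrow>
     feasible_batches w K s (batches \<pi>) \<and> follows sys w s \<pi> \<and>
     (\<forall>bs. feasible_batches w K s bs \<longrightarrow>
        plan_completion sys w s (batches \<pi>) \<le> plan_completion sys w s bs)"

text \<open>
  A deterministic way to choose among the optimal plans, given the orders \<open>K\<close> that have arrived
  and the current state.
\<close>

definition reopt_rule :: "system \<Rightarrow> warehouse \<Rightarrow> (inst \<Rightarrow> state \<Rightarrow> plan) \<Rightarrow> bool" where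
  "reopt_rule sys w rule \<longleftrightarrow>
     (\<forall>K s. valid_inst w K \<and> position s \<in> grid w \<and> (\<exists>bs. feasible_batches w K s bs) \<longrightarrow>
        optimal_plan sys w K s (rule K s))"

fun execute :: "(stop \<times> real \<times> point) list \<Rightarrow> state \<Rightarrow> state" where
  "execute [] s = s"
| "execute ((Pick j x, u, q) # es) s =
     execute es (s\<lparr>clock := u, position := q, cart := insert j (cart s),
                   picked := (picked s)((j, x) \<mapsto> u)\<rparr>)"
| "execute ((Finish, u, q) # es) s =
     execute es (s\<lparr>clock := u, position := q, cart := {}\<rparr>)"

definition initial :: "warehouse \<Rightarrow> state" where
  "initial w = \<lparr>clock = 0, position = depot w, cart = {}, picked = Map.empty\<rparr>"


subsection \<open>Interventionist reoptimization\<close>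

definition advance :: "system \<Rightarrow> warehouse \<Rightarrow> real \<Rightarrow> state \<Rightarrow> plan \<Rightarrow> state" where
  "advance sys w t s \<pi> =
     (execute (filter (\<lambda>(x, u, q). u \<le> t) (plan_schedule sys w s (batches \<pi>))) s)
       \<lparr>clock := t, position := path \<pi> t\<rparr>"

definition intervene :: "system \<Rightarrow> warehouse \<Rightarrow> (inst \<Rightarrow> state \<Rightarrow> plan) \<Rightarrow> inst \<Rightarrow>
    real \<Rightarrow> state \<times> plan \<Rightarrow> state \<times> plan" where
  "intervene sys w rule I t = (\<lambda>(s, \<pi>).
     let s' = advance sys w t s \<pi> in (s', rule (known I t) s'))"

text \<open>Orders that arrive simultaneously cause a single reoptimization.\<close>

definition run_interventionist :: "system \<Rightarrow> warehouse \<Rightarrow> (inst \<Rightarrow> state \<Rightarrow> plan) \<Rightarrow> inst \<Rightarrow> state"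
  where
  "run_interventionist sys w rule I =
     (let (s, \<pi>) = fold (intervene sys w rule I) (sorted_list_of_set (set (map snd I)))
                     (initial w, \<lparr>batches = [], path = \<lambda>_. depot w\<rparr>)
      in execute (plan_schedule sys w s (batches \<pi>)) s)"


subsection \<open>Non-interventionist reoptimization\<close>

text \<open>
  One step processes one batch, starting at the depot, after waiting for the next arrival if
  nothing is left to do. \<open>bs\<close> are the batches of the current plan that have not been started, and
  \<open>K\<close> are the orders that had arrived at the last reoptimization.
\<close>

definition noninterventionist_step :: "system \<Rightarrow> warehouse \<Rightarrow> (inst \<Rightarrow> state \<Rightarrow> plan) \<Rightarrow> inst \<Rightarrow>
    state \<times> item list list \<times> inst \<Rightarrow> state \<times> item list list \<times> inst" where
  "noninterventionist_step sys w rule I = (\<lambda>(s, bs, K).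
     if items I \<subseteq> dom (picked s) then (s, bs, K)
     else
       let t = (if items (known I (clock s)) \<subseteq> dom (picked s)
                then Min {r \<in> set (map snd I). clock s < r} else clock s);
           s' = s\<lparr>clock := t\<rparr>;
           K' = known I t;
           bs' = (if K' = K then bs else batches (rule K' s'))
       in (execute (plan_schedule sys w s' [hd bs']) s', tl bs', K'))"

text \<open>Each step completes at least one order, so \<open>length I\<close> steps suffice.\<close>

definition run_noninterventionist :: "system \<Rightarrow> warehouse \<Rightarrow> (inst \<Rightarrow> state \<Rightarrow> plan) \<Rightarrow> inst \<Rightarrow> state"
  where
  "run_noninterventionist sys w rule I =
     fst ((noninterventionist_step sys w rule I ^^ length I) (initial w, [], []))"


subsection \<open>Completion time and pending orders\<close>

definition reopt_run :: "system \<Rightarrow> warehouse \<Rightarrow> (inst \<Rightarrow> state \<Rightarrow> plan) \<Rightarrow> inst \<Rightarrow> state" where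
  "reopt_run sys w rule I =
     (if sys = PcartN then run_noninterventionist sys w rule I
      else run_interventionist sys w rule I)"

definition reopt :: "system \<Rightarrow> warehouse \<Rightarrow> (inst \<Rightarrow> state \<Rightarrow> plan) \<Rightarrow> inst \<Rightarrow> real" where
  "reopt sys w rule I = clock (reopt_run sys w rule I)"

definition pending :: "system \<Rightarrow> warehouse \<Rightarrow> (inst \<Rightarrow> state \<Rightarrow> plan) \<Rightarrow> inst \<Rightarrow> real \<Rightarrow> nat set"
  where
  "pending sys w rule I t =
     {j. j < length I \<and> snd (I ! j) \<le> t \<and>
         (\<exists>s \<in> fst (I ! j). \<not> (\<exists>u\<le>t. picked (reopt_run sys w rule I) (j, s) = Some u))}"


section \<open>Random instances\<close>

text \<open>
  A random order takes values in the lists of distinct picking locations. They carry the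
  \<open>\<sigma>\<close>-algebra generated by the length and the individual entries.
\<close>

definition order_space :: "point list measure" where
  "order_space =
     vimage_algebra UNIV (\<lambda>xs. (length xs, \<lambda>i. if i < length xs then xs ! i else 0))
       (count_space UNIV \<Otimes>\<^sub>M (\<Pi>\<^sub>M i \<in> (UNIV :: nat set). (borel :: point measure)))"

definition order_list :: "warehouse \<Rightarrow> point list \<Rightarrow> bool" where
  "order_list w xs \<longleftrightarrow> xs \<noteq> [] \<and> distinct xs \<and> set xs \<subseteq> aisles w"

definition rand_inst :: "(nat \<Rightarrow> 'w \<Rightarrow> point list) \<Rightarrow> (nat \<Rightarrow> 'w \<Rightarrow> real) \<Rightarrow> nat \<Rightarrow> 'w \<Rightarrow> inst" where
  "rand_inst Os X n \<omega> = map (\<lambda>j. (set (Os j \<omega>), \<Sum>i\<le>j. X i \<omega>)) [0..<n]"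

end

theory Submission
  imports Defs
begin

text \<open>
  The offline optimum cannot be smaller than the time \<open>R\<close> of the last arrival. Every run of Reopt
  is one particular offline solution, so it costs at least the optimum. The point is the reverse
  estimate: Reopt needs at most \<open>R + D * (1 + p)\<close>, where \<open>p\<close> is the number of orders pending at time
  \<open>R\<close> and \<open>D\<close> depends on the warehouse and the capacity only. These three inequalities
  (\<open>reopt_close_to_ciopt\<close>) hold for every single instance. Randomness enters only through the
  arrival times: almost surely \<open>R\<close> is at least \<open>\<epsilon> * n\<close> for all large \<open>n\<close>
  (\<open>exponential_partial_sums_linear\<close>), so if \<open>p / n\<close> tends to \<open>0\<close>, then the additive error
  \<open>D * (1 + p)\<close> is negligible compared with the optimum (\<open>ratio_tendsto_1\<close>).

  The constant \<open>D\<close> exists although orders may contain arbitrarily many locations, because all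
  locations of an order can be visited by going through each aisle once (\<open>bounded_tour\<close>).
  An optimal plan therefore has no batch that takes longer than \<open>D\<close>: resequencing that
  batch alone would improve the plan (\<open>optimal_batch_length\<close>). After time \<open>R\<close> nothing arrives
  any more. Completing the batch that is in progress at time \<open>R\<close>, or starts then, takes at most \<open>D\<close>.
  Each later batch takes at most \<open>D\<close> and picks, after time \<open>R\<close>, an order that no earlier batch has
  touched (\<open>execute_batch\<close>).
  Counting these orders, all of them pending at time \<open>R\<close>, gives the bound.

  That a run is an offline solution is proved by following it stop by stop (\<open>execute_prefix\<close>). The
  batches finished so far, the contents of the cart and the rest of the plan together always form a
  batching, and a picker who performs the same stops as early as the releases permit is never
  behind the actual one, even if the latter is interrupted on her way (\<open>ahead_after\<close>,
  \<open>sound_advance\<close>).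
\<close>

section \<open>Distances and tours in the grid\<close>

definition travels :: "warehouse \<Rightarrow> real \<Rightarrow> point \<Rightarrow> point \<Rightarrow> bool" where
  "travels w T p q \<longleftrightarrow> 0 \<le> T \<and>
     (\<exists>\<gamma>. 1-lipschitz_on {0..T} \<gamma> \<and> \<gamma> ` {0..T} \<subseteq> grid w \<and> \<gamma> 0 = p \<and> \<gamma> T = q)"

lemma gdist_eq_Inf_travels: "gdist w p q = Inf {T. travels w T p q}"
  by (simp add: gdist_def travels_def)

lemma travels_refl: "p \<in> grid w \<Longrightarrow> travels w 0 p p"
  by (auto simp: travels_def intro!: exI[of _ "\<lambda>_. p"] lipschitz_intros)

lemma travels_trans:
  assumes "travels w S p q" "travels w T q r"
  shows "travels w (S + T) p r"
proof -
  from assms obtain f g where S: "0 \<le> S" and T: "0 \<le> T"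
    and f: "1-lipschitz_on {0..S} f" "f ` {0..S} \<subseteq> grid w" "f 0 = p" "f S = q"
    and g: "1-lipschitz_on {0..T} g" "g ` {0..T} \<subseteq> grid w" "g 0 = q" "g T = r"
    by (auto simp: travels_def)
  let ?h = "\<lambda>u. if u \<le> S then f u else g (u - S)"
  have "1-lipschitz_on {S..S + T} (\<lambda>u. g (u - S))"
  proof (rule lipschitz_onI)
    fix u v assume "u \<in> {S..S + T}" "v \<in> {S..S + T}"
    then show "dist (g (u - S)) (g (v - S)) \<le> 1 * dist u v"
      using lipschitz_onD[OF g(1), of "u - S" "v - S"] by (auto simp: dist_real_def)
  qed simp
  then have "1-lipschitz_on {0..S + T} ?h"
    by (rule lipschitz_on_concat[OF f(1)]) (use f g in auto)
  moreover have "?h ` {0..S + T} \<subseteq> grid w"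
    using f(2) g(2) by auto
  moreover have "?h 0 = p" "?h (S + T) = r"
    using S T f(3,4) g(3,4) by (auto simp: not_le)
  ultimately show ?thesis
    unfolding travels_def using S T by (intro conjI exI[of _ ?h]) auto
qed

lemma travels_sym:
  assumes "travels w T p q"
  shows "travels w T q p"
proof -
  from assms obtain f where T: "0 \<le> T"
    and f: "1-lipschitz_on {0..T} f" "f ` {0..T} \<subseteq> grid w" "f 0 = p" "f T = q"
    by (auto simp: travels_def)
  have "1-lipschitz_on {0..T} (\<lambda>u. f (T - u))"
  proof (rule lipschitz_onI)
    fix u v assume "u \<in> {0..T}" "v \<in> {0..T}"
    then show "dist (f (T - u)) (f (T - v)) \<le> 1 * dist u v"
      using lipschitz_onD[OF f(1), of "T - u" "T - v"] by (auto simp: dist_real_def)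
  qed simp
  then show ?thesis
    unfolding travels_def using T f by (intro conjI exI[of _ "\<lambda>u. f (T - u)"]) auto
qed

lemma travels_segment:
  assumes "closed_segment p q \<subseteq> grid w"
  shows "travels w (dist p q) p q"
proof (cases "p = q")
  case True
  then show ?thesis using assms by (auto intro: travels_refl)
next
  case False
  define D where "D = dist p q"
  have D: "0 < D" using False by (simp add: D_def)
  let ?g = "\<lambda>u. p + (u / D) *\<^sub>R (q - p)"
  have "1-lipschitz_on {0..D} ?g"
  proof (rule lipschitz_onI)
    fix u v
    have "?g u - ?g v = ((u - v) / D) *\<^sub>R (q - p)"
      by (simp add: algebra_simps diff_divide_distrib)
    then have "dist (?g u) (?g v) = \<bar>u - v\<bar> / D * norm (q - p)"
      using D by (simp add: dist_norm)
    also have "\<dots> = dist u v"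
      using D by (simp add: D_def dist_norm norm_minus_commute)
    finally show "dist (?g u) (?g v) \<le> 1 * dist u v" by simp
  qed simp
  moreover have "?g u \<in> closed_segment p q" if "u \<in> {0..D}" for u
    unfolding in_segment using that D
    by (intro exI[of _ "u / D"]) (auto simp: algebra_simps)
  ultimately show ?thesis
    unfolding travels_def D_def[symmetric] using D assms
    by (intro conjI exI[of _ ?g]) auto
qed

locale valid_grid =
  fixes w :: warehouse
  assumes valid_w: "valid_warehouse w"
begin

abbreviation aisle_x :: "nat \<Rightarrow> real" where
  "aisle_x i \<equiv> real i * wh_length w / real (n_aisles w - 1)"

lemma aisles_in_grid: "aisles w \<subseteq> grid w"
  by (simp add: grid_def)

lemma depot_in_grid: "depot w \<in> grid w"
  using valid_w by (simp add: valid_warehouse_def)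

lemma wh_dims: "0 \<le> wh_length w" "0 < wh_width w"
  using valid_w by (auto simp: valid_warehouse_def split: if_splits)

lemma aisle_x_bounds:
  assumes "i < n_aisles w"
  shows "0 \<le> aisle_x i" "aisle_x i \<le> wh_length w"
proof -
  show "0 \<le> aisle_x i" using wh_dims by simp
  show "aisle_x i \<le> wh_length w"
  proof (cases "n_aisles w = 1")
    case False
    then have "real i * wh_length w \<le> real (n_aisles w - 1) * wh_length w"
      using assms wh_dims by (intro mult_right_mono) auto
    then show ?thesis using False assms by (simp add: field_simps)
  qed (use wh_dims in simp)
qed

lemma travels_in_aisle:
  assumes "i < n_aisles w" "y \<in> {0..wh_width w}" "y' \<in> {0..wh_width w}"
  shows "travels w \<bar>y - y'\<bar> (aisle_x i, y) (aisle_x i, y')"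
proof -
  have "closed_segment (aisle_x i, y) (aisle_x i, y') \<subseteq> {aisle_x i} \<times> {0..wh_width w}"
    using assms by (intro closed_segment_subset convex_Times) auto
  also have "\<dots> \<subseteq> grid w" using assms by (auto simp: grid_def aisles_def)
  finally have "travels w (dist (aisle_x i, y) (aisle_x i, y')) (aisle_x i, y) (aisle_x i, y')"
    by (rule travels_segment)
  then show ?thesis by (simp add: dist_Pair_Pair dist_real_def)
qed

lemma travels_in_cross_aisle:
  assumes "i < n_cross w" "x \<in> {0..wh_length w}" "x' \<in> {0..wh_length w}"
  shows "travels w \<bar>x - x'\<bar> (x, real i * wh_width w / real (n_cross w - 1))
           (x', real i * wh_width w / real (n_cross w - 1))"
proof -
  let ?y = "real i * wh_width w / real (n_cross w - 1)"
  have "closed_segment (x, ?y) (x', ?y) \<subseteq> {0..wh_length w} \<times> {?y}"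
    using assms by (intro closed_segment_subset convex_Times) auto
  also have "\<dots> \<subseteq> grid w" using assms by (auto simp: grid_def cross_aisles_def)
  finally have "travels w (dist (x, ?y) (x', ?y)) (x, ?y) (x', ?y)"
    by (rule travels_segment)
  then show ?thesis by (simp add: dist_Pair_Pair dist_real_def)
qed

text \<open>An aisle leads to the cross-aisle at height \<open>0\<close>, and a cross-aisle to the aisle at
  abscissa \<open>0\<close>, so every point is joined to the corner \<open>(0, 0)\<close>.\<close>

lemma travels_to_corner:
  assumes "p \<in> grid w"
  shows "\<exists>T \<le> wh_length w + wh_width w. travels w T p (0, 0)"
  using assms unfolding grid_def
proof
  assume "p \<in> aisles w"
  then obtain i y where p: "p = (aisle_x i, y)" "i < n_aisles w" "y \<in> {0..wh_width w}"
    unfolding aisles_def by blast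
  have "travels w \<bar>y - 0\<bar> p (aisle_x i, 0)"
    unfolding p(1) by (rule travels_in_aisle) (use p wh_dims in auto)
  moreover have "travels w \<bar>aisle_x i - 0\<bar> (aisle_x i, 0) (0, 0)"
    using travels_in_cross_aisle[of 0 "aisle_x i" 0] p aisle_x_bounds[OF p(2)] wh_dims valid_w
    by (simp add: valid_warehouse_def)
  ultimately have "travels w (\<bar>y - 0\<bar> + \<bar>aisle_x i - 0\<bar>) p (0, 0)"
    by (rule travels_trans)
  moreover have "\<bar>y - 0\<bar> + \<bar>aisle_x i - 0\<bar> \<le> wh_length w + wh_width w"
    using p(3) aisle_x_bounds[OF p(2)] by (simp add: abs_of_nonneg)
  ultimately show ?thesis by blast
next
  assume "p \<in> cross_aisles w"
  then obtain i x where p: "p = (x, real i * wh_width w / real (n_cross w - 1))"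
      "i < n_cross w" "x \<in> {0..wh_length w}"
    unfolding cross_aisles_def by blast
  define y where "y = real i * wh_width w / real (n_cross w - 1)"
  have n: "real i \<le> real (n_cross w - 1)" "0 < real (n_cross w - 1)"
    using p(2) valid_w by (auto simp: valid_warehouse_def)
  have y: "y \<in> {0..wh_width w}"
    using mult_right_mono[OF n(1), of "wh_width w"] n(2) wh_dims by (auto simp: y_def field_simps)
  have "travels w \<bar>x - 0\<bar> p (0, y)"
    unfolding p(1) y_def by (rule travels_in_cross_aisle) (use p wh_dims in auto)
  moreover have "travels w \<bar>y - 0\<bar> (0, y) (0, 0)"
    using travels_in_aisle[of 0 y 0] y wh_dims valid_w by (simp add: valid_warehouse_def)
  ultimately have "travels w (\<bar>x - 0\<bar> + \<bar>y - 0\<bar>) p (0, 0)"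
    by (rule travels_trans)
  moreover have "\<bar>x - 0\<bar> + \<bar>y - 0\<bar> \<le> wh_length w + wh_width w"
    using p(3) y by auto
  ultimately show ?thesis by blast
qed

definition diam :: real where
  "diam = 2 * (wh_length w + wh_width w)"

lemma diam_nonneg: "0 \<le> diam"
  using wh_dims by (simp add: diam_def)

lemma travels_within_diam:
  assumes "p \<in> grid w" "q \<in> grid w"
  shows "\<exists>T \<le> diam. travels w T p q"
proof -
  obtain S T where "S \<le> wh_length w + wh_width w" "travels w S p (0, 0)"
      "T \<le> wh_length w + wh_width w" "travels w T q (0, 0)"
    using travels_to_corner assms by meson
  then have "travels w (S + T) p q" "S + T \<le> diam"
    by (auto simp: diam_def intro: travels_trans travels_sym)
  then show ?thesis by blast
qed

lemma gdist_le: "travels w T p q \<Longrightarrow> gdist w p q \<le> T"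
  unfolding gdist_eq_Inf_travels
  by (intro cInf_lower bdd_belowI[of _ 0]) (auto simp: travels_def)

lemma gdist_nonneg:
  assumes "p \<in> grid w" "q \<in> grid w"
  shows "0 \<le> gdist w p q"
  unfolding gdist_eq_Inf_travels
  using travels_within_diam[OF assms] by (intro cInf_greatest) (auto simp: travels_def)

lemma gdist_le_diam: "p \<in> grid w \<Longrightarrow> q \<in> grid w \<Longrightarrow> gdist w p q \<le> diam"
  using travels_within_diam gdist_le by fastforce

lemma gdist_refl: "p \<in> grid w \<Longrightarrow> gdist w p p = 0"
  using gdist_le[OF travels_refl] gdist_nonneg by (simp add: order_antisym)

lemma gdist_triangle:
  assumes "p \<in> grid w" "q \<in> grid w" "r \<in> grid w"
  shows "gdist w p r \<le> gdist w p q + gdist w q r"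
proof -
  have "gdist w p r - T \<le> gdist w p q" if T: "travels w T q r" for T
    unfolding gdist_eq_Inf_travels[of w p q]
  proof (rule cInf_greatest)
    show "{S. travels w S p q} \<noteq> {}" using travels_within_diam assms by blast
    fix S assume "S \<in> {S. travels w S p q}"
    then show "gdist w p r - T \<le> S" using gdist_le[OF travels_trans[OF _ T]] by fastforce
  qed
  then have "gdist w p r - gdist w p q \<le> T" if "travels w T q r" for T
    using that by fastforce
  then have "gdist w p r - gdist w p q \<le> gdist w q r"
    unfolding gdist_eq_Inf_travels[of w q r]
    using travels_within_diam[OF assms(2,3)] by (intro cInf_greatest) auto
  then show ?thesis by simp
qed

lemma gdist_along_path:
  assumes lip: "1-lipschitz_on {a..} f" and im: "f ` {a..} \<subseteq> grid w" and "a \<le> u" "u \<le> v"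
  shows "gdist w (f u) (f v) \<le> v - u"
proof (rule gdist_le)
  have "1-lipschitz_on {0..v - u} (\<lambda>x. f (u + x))"
  proof (rule lipschitz_onI)
    fix x y assume "x \<in> {0..v - u}" "y \<in> {0..v - u}"
    then show "dist (f (u + x)) (f (u + y)) \<le> 1 * dist x y"
      using lipschitz_onD[OF lip, of "u + x" "u + y"] \<open>a \<le> u\<close> by (auto simp: dist_real_def)
  qed simp
  then show "travels w (v - u) (f u) (f v)"
    unfolding travels_def using assms by (intro conjI exI[of _ "\<lambda>x. f (u + x)"]) auto
qed

fun walk :: "point \<Rightarrow> point list \<Rightarrow> real" where
  "walk p [] = 0"
| "walk p (q # qs) = gdist w p q + walk q qs"

lemma walk_append: "walk p (xs @ ys) = walk p xs + walk (last (p # xs)) ys"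
  by (induction xs arbitrary: p) auto

lemma walk_nonneg: "p \<in> grid w \<Longrightarrow> set xs \<subseteq> grid w \<Longrightarrow> 0 \<le> walk p xs"
  by (induction xs arbitrary: p) (auto simp: gdist_nonneg)

lemma last_in_grid: "p \<in> grid w \<Longrightarrow> set xs \<subseteq> grid w \<Longrightarrow> last (p # xs) \<in> grid w"
  using last_in_set[of "p # xs"] by auto

lemma walk_up_aisle:
  assumes "i < n_aisles w" "sorted (y # ys)" "set (y # ys) \<subseteq> {0..wh_width w}"
  shows "walk (aisle_x i, y) (map (Pair (aisle_x i)) ys) \<le> wh_width w - y"
  using assms(2,3)
proof (induction ys arbitrary: y)
  case (Cons z zs)
  have "gdist w (aisle_x i, y) (aisle_x i, z) \<le> z - y"
    using gdist_le[OF travels_in_aisle[OF assms(1), of y z]] Cons.prems by auto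
  with Cons.IH[of z] Cons.prems show ?case by auto
qed auto

text \<open>Sorted by their ordinate, the locations in one aisle are passed in a single movement.\<close>

lemma aisle_walk:
  assumes "i < n_aisles w" "finite F" "F \<subseteq> {aisle_x i} \<times> {0..wh_width w}"
  shows "\<exists>xs. distinct xs \<and> set xs = F \<and> (\<forall>p \<in> grid w. walk p xs \<le> diam + wh_width w)"
proof -
  define ys where "ys = sorted_list_of_set (snd ` F)"
  let ?xs = "map (Pair (aisle_x i)) ys"
  have ys: "sorted ys" "distinct ys" "set ys = snd ` F" "set ys \<subseteq> {0..wh_width w}"
    using assms by (auto simp: ys_def)
  have sub: "set ?xs \<subseteq> grid w"
    using ys(4) assms(1) by (auto simp: grid_def aisles_def)
  have "walk p ?xs \<le> diam + wh_width w" if p: "p \<in> grid w" for p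
  proof (cases ys)
    case Nil
    then show ?thesis using diam_nonneg wh_dims by simp
  next
    case (Cons z zs)
    have "gdist w p (aisle_x i, z) \<le> diam"
      using sub p Cons by (intro gdist_le_diam) auto
    moreover have "walk (aisle_x i, z) (map (Pair (aisle_x i)) zs) \<le> wh_width w - z"
      by (rule walk_up_aisle[OF assms(1)]) (use ys Cons in auto)
    moreover have "0 \<le> z" using ys(4) Cons by simp
    ultimately show ?thesis using Cons by simp
  qed
  moreover have "distinct ?xs" using ys(2) by (simp add: distinct_map inj_on_def)
  moreover have "set ?xs = F" using ys(3) assms(3) by force
  ultimately show ?thesis by blast
qed

definition tour_bound :: real where
  "tour_bound = real (n_aisles w) * (diam + wh_width w)"

text \<open>
  The bound does not depend on the number of locations, since it suffices to go through each aisle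
  once.
\<close>

lemma bounded_tour:
  assumes "finite F" "F \<subseteq> aisles w"
  shows "\<exists>xs. distinct xs \<and> set xs = F \<and> (\<forall>p \<in> grid w. walk p xs \<le> tour_bound)"
proof -
  have "\<exists>xs. distinct xs \<and> set xs = F \<and>
      (\<forall>p \<in> grid w. walk p xs \<le> real m * (diam + wh_width w))"
    if "m \<le> n_aisles w" "finite F" "F \<subseteq> (\<Union>i<m. {aisle_x i} \<times> {0..wh_width w})" for m F
    using that
  proof (induction m arbitrary: F)
    case 0
    then show ?case by auto
  next
    case (Suc m)
    let ?A = "{aisle_x m} \<times> {0..wh_width w}"
    have "F - ?A \<subseteq> (\<Union>i<m. {aisle_x i} \<times> {0..wh_width w})"
      using Suc.prems(3) unfolding lessThan_Suc by blast
    then obtain xs where xs: "distinct xs" "set xs = F - ?A"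
        "\<And>p. p \<in> grid w \<Longrightarrow> walk p xs \<le> real m * (diam + wh_width w)"
      using Suc.IH[of "F - ?A"] Suc.prems(1,2) by (auto simp del: of_nat_diff)
    obtain ys where ys: "distinct ys" "set ys = F \<inter> ?A"
        "\<And>p. p \<in> grid w \<Longrightarrow> walk p ys \<le> diam + wh_width w"
      using aisle_walk[of m "F \<inter> ?A"] Suc.prems(1,2) by auto
    have "F - ?A \<subseteq> grid w"
      using Suc.prems by (fastforce simp: grid_def aisles_def)
    then have "walk p (xs @ ys) \<le> real (Suc m) * (diam + wh_width w)" if "p \<in> grid w" for p
      using xs(3)[OF that] ys(3)[OF last_in_grid[OF that, of xs]] xs(2)
      by (simp add: walk_append algebra_simps)
    moreover have "distinct (xs @ ys)" "set (xs @ ys) = F" using xs ys by auto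
    ultimately show ?case by blast
  qed
  from this[OF order_refl assms(1)] assms(2) show ?thesis
    by (simp add: tour_bound_def aisles_def)
qed

text \<open>The orders of a batch can be served one after the other, each on a tour of its own.\<close>

lemma bounded_item_tour:
  assumes "finite X" "snd ` X \<subseteq> aisles w"
  shows "\<exists>b :: item list. distinct b \<and> set b = X \<and>
     (\<forall>p \<in> grid w. walk p (map snd b) \<le> real (card (fst ` X)) * tour_bound)"
proof -
  have "\<exists>b :: item list. distinct b \<and> set b = X \<and>
     (\<forall>p \<in> grid w. walk p (map snd b) \<le> real (card J) * tour_bound)"
    if "finite J" "fst ` X = J" "finite X" "snd ` X \<subseteq> aisles w" for J X
    using that
  proof (induction J arbitrary: X)
    case empty
    then show ?case by auto
  next
    case (insert j J)
    let ?Y = "{i \<in> X. fst i \<noteq> j}" and ?F = "{s. (j, s) \<in> X}"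
    have "\<exists>b. distinct b \<and> set b = ?Y \<and>
        (\<forall>p \<in> grid w. walk p (map snd b) \<le> real (card J) * tour_bound)"
    proof (rule insert.IH)
      show "fst ` ?Y = J" using insert.prems(1) insert.hyps(2) by force
    qed (use insert.prems in auto)
    then obtain b where b: "distinct b" "set b = ?Y"
        "\<And>p. p \<in> grid w \<Longrightarrow> walk p (map snd b) \<le> real (card J) * tour_bound" by auto
    have "?F \<subseteq> snd ` X" by force
    then have "finite ?F" "?F \<subseteq> aisles w" using insert.prems finite_surj by blast+
    then obtain xs where xs: "distinct xs" "set xs = ?F"
        "\<And>p. p \<in> grid w \<Longrightarrow> walk p xs \<le> tour_bound" using bounded_tour by meson
    let ?c = "b @ map (Pair j) xs"
    have "set (map snd b) \<subseteq> grid w"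
      using b(2) insert.prems aisles_in_grid by auto
    then have "walk p (map snd ?c) \<le> real (card (insert j J)) * tour_bound" if "p \<in> grid w" for p
      using b(3)[OF that] xs(3)[OF last_in_grid[OF that, of "map snd b"]] insert.hyps
      by (simp add: walk_append algebra_simps comp_def)
    moreover have "distinct ?c" using b xs by (auto simp: distinct_map inj_on_def)
    moreover have "set ?c = X" using b(2) xs(2) by force
    ultimately show ?case by blast
  qed
  from this[OF finite_imageI[OF assms(1)] refl assms] show ?thesis .
qed

definition batch_bound :: real where
  "batch_bound = real (capacity w) * tour_bound + 2 * diam"

lemma tour_bound_nonneg: "0 \<le> tour_bound"
  using wh_dims diam_nonneg by (simp add: tour_bound_def)

lemma batch_bound_nonneg: "0 \<le> batch_bound"
  using tour_bound_nonneg diam_nonneg by (simp add: batch_bound_def)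

end

section \<open>Schedules as iterated stops\<close>

abbreviation picks :: "item list \<Rightarrow> stop list" where
  "picks b \<equiv> map (\<lambda>(j, s). Pick j s) b"

lemma stops_Nil [simp]: "stops [] = []"
  by (simp add: stops_def)

lemma stops_Cons: "stops (b # bs) = picks b @ Finish # stops bs"
  by (simp add: stops_def)

lemma stops_append: "stops (as @ bs) = stops as @ stops bs"
  by (simp add: stops_def)

lemma Finish_notin_picks [simp]: "Finish \<notin> set (picks b)"
  by auto

lemma picks_inj: "picks b = picks c \<Longrightarrow> b = c"
  by (rule map_injective) (auto intro!: injI)

lemma Pick_in_stops: "Pick j s \<in> set (stops bs) \<longleftrightarrow> (j, s) \<in> set (concat bs)"
  by (induction bs) (auto simp: stops_Cons)

text \<open>
  Since \<open>Finish\<close> separates the batches, what remains of a plan is determined by the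
  stops that remain.
\<close>

lemma stops_inj: "stops as = stops bs \<Longrightarrow> as = bs"
proof (induction as arbitrary: bs)
  case Nil
  then show ?case by (cases bs) (auto simp: stops_Cons)
next
  case (Cons a as)
  then obtain b bs' where bs: "bs = b # bs'" by (cases bs) (auto simp: stops_Cons)
  have eq: "picks a @ Finish # stops as = picks b @ Finish # stops bs'"
    using Cons.prems bs by (simp add: stops_Cons)
  moreover have "takeWhile (\<lambda>x. x \<noteq> Finish) (picks c @ Finish # xs) = picks c" for c xs
    by (subst takeWhile_append2) auto
  ultimately have "picks a = picks b" by metis
  then show ?case using eq Cons.IH bs picks_inj by auto
qed

locale picking = valid_grid +
  fixes sys :: system
begin

definition after_stop :: "(nat \<Rightarrow> real) \<Rightarrow> stop \<Rightarrow> real \<times> point \<Rightarrow> real \<times> point" where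
  "after_stop r x \<sigma> = (case x of
     Pick j s \<Rightarrow> (max (fst \<sigma> + gdist w (snd \<sigma>) s) (r j), s)
   | Finish \<Rightarrow> (let q = if sys = Robot then snd \<sigma> else depot w
                in (fst \<sigma> + gdist w (snd \<sigma>) q, q)))"

abbreviation after :: "(nat \<Rightarrow> real) \<Rightarrow> stop list \<Rightarrow> real \<times> point \<Rightarrow> real \<times> point" where
  "after r \<equiv> fold (after_stop r)"

abbreviation sched :: "(nat \<Rightarrow> real) \<Rightarrow> real \<times> point \<Rightarrow> stop list \<Rightarrow> (stop \<times> real \<times> point) list" where
  "sched r \<sigma> \<equiv> schedule sys w r (fst \<sigma>) (snd \<sigma>)"

abbreviation on_grid :: "stop list \<Rightarrow> bool" where
  "on_grid xs \<equiv> (\<forall>j s. Pick j s \<in> set xs \<longrightarrow> s \<in> grid w)"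

lemma sched_Cons: "sched r \<sigma> (x # xs) = (x, after_stop r x \<sigma>) # sched r (after_stop r x \<sigma>) xs"
  by (cases x) (auto simp: after_stop_def Let_def)

lemma sched_append: "sched r \<sigma> (xs @ ys) = sched r \<sigma> xs @ sched r (after r xs \<sigma>) ys"
  by (induction xs arbitrary: \<sigma>) (auto simp: sched_Cons simp del: schedule.simps(2,3))

lemma fst_sched: "map fst (sched r \<sigma> xs) = xs"
  by (induction xs arbitrary: \<sigma>) (auto simp: sched_Cons simp del: schedule.simps(2,3))

lemma last_sched: "last (fst \<sigma> # map (fst \<circ> snd) (sched r \<sigma> xs)) = fst (after r xs \<sigma>)"
  by (induction xs arbitrary: \<sigma>) (auto simp: sched_Cons simp del: schedule.simps(2,3))

lemma completion_eq: "completion sys w r t p bs = fst (after r (stops bs) (t, p))"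
  using last_sched[of "(t, p)"] by (simp add: completion_def)

text \<open>
  The situation reached after some stops is an entry of the schedule, so that a picker who follows the
  plan is known to be there at that time.
\<close>

lemma after_in_sched:
  assumes "xs = d @ e"
  shows "after r d \<sigma> = \<sigma> \<or> (\<exists>x. (x, after r d \<sigma>) \<in> set (sched r \<sigma> xs))"
  using assms
proof (induction d arbitrary: e rule: rev_induct)
  case (snoc x d)
  then show ?case
    by (auto simp: sched_append sched_Cons simp del: schedule.simps(2,3))
qed simp

lemma after_stop_in_grid:
  "snd \<sigma> \<in> grid w \<Longrightarrow> on_grid [x] \<Longrightarrow> snd (after_stop r x \<sigma>) \<in> grid w"
  using depot_in_grid by (cases x) (auto simp: after_stop_def Let_def)

lemma after_in_grid: "snd \<sigma> \<in> grid w \<Longrightarrow> on_grid xs \<Longrightarrow> snd (after r xs \<sigma>) \<in> grid w"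
proof (induction xs arbitrary: \<sigma>)
  case (Cons x xs)
  have "snd (after_stop r x \<sigma>) \<in> grid w"
    using Cons.prems by (intro after_stop_in_grid) auto
  then show ?case using Cons by simp
qed simp

lemma after_stop_later:
  assumes "snd \<sigma> \<in> grid w" "on_grid [x]"
  shows "fst \<sigma> \<le> fst (after_stop r x \<sigma>)"
  using assms depot_in_grid gdist_nonneg[of "snd \<sigma>"]
  by (cases x) (auto simp: after_stop_def Let_def le_max_iff_disj)

lemma sched_later:
  assumes "snd \<sigma> \<in> grid w" "on_grid xs" "(x, u, q) \<in> set (sched r \<sigma> xs)"
  shows "fst \<sigma> \<le> u"
  using assms
proof (induction xs arbitrary: \<sigma>)
  case (Cons y ys)
  have "snd (after_stop r y \<sigma>) \<in> grid w" "fst \<sigma> \<le> fst (after_stop r y \<sigma>)"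
    using Cons.prems after_stop_in_grid after_stop_later by auto
  moreover have "(x, u, q) = (y, after_stop r y \<sigma>) \<or> (x, u, q) \<in> set (sched r (after_stop r y \<sigma>) ys)"
    using Cons.prems(3) unfolding sched_Cons by simp
  ultimately show ?case
    using Cons.IH[of "after_stop r y \<sigma>"] Cons.prems(2) by (metis Pair_inject eq_fst_iff list.set_intros(2) order_trans)
qed simp

lemma after_later:
  assumes "snd \<sigma> \<in> grid w" "on_grid xs"
  shows "fst \<sigma> \<le> fst (after r xs \<sigma>)"
  using after_in_sched[of xs xs "[]" r \<sigma>] sched_later[OF assms] by (metis append_Nil2 order_refl prod.collapse)

text \<open>The stops performed by time \<open>t\<close> form a prefix because times increase along a schedule.\<close>

lemma sched_until:
  assumes "snd \<sigma> \<in> grid w" "on_grid xs" "fst \<sigma> \<le> t"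
  shows "\<exists>d e. xs = d @ e \<and> filter (\<lambda>(x, u, q). u \<le> t) (sched r \<sigma> xs) = sched r \<sigma> d \<and>
     fst (after r d \<sigma>) \<le> t"
  using assms
proof (induction xs arbitrary: \<sigma>)
  case (Cons x xs)
  let ?\<tau> = "after_stop r x \<sigma>"
  have g: "snd ?\<tau> \<in> grid w" using Cons.prems by (intro after_stop_in_grid) auto
  have og: "on_grid xs" using Cons.prems by auto
  show ?case
  proof (cases "fst ?\<tau> \<le> t")
    case True
    then obtain d e where "xs = d @ e" "filter (\<lambda>(x, u, q). u \<le> t) (sched r ?\<tau> xs) = sched r ?\<tau> d"
        "fst (after r d ?\<tau>) \<le> t"
      using Cons.IH[OF g og] by auto
    then have "x # xs = (x # d) @ e" "fst (after r (x # d) \<sigma>) \<le> t"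
      "filter (\<lambda>(x, u, q). u \<le> t) (sched r \<sigma> (x # xs)) = sched r \<sigma> (x # d)"
      using True by (simp_all add: sched_Cons case_prod_beta del: schedule.simps(2,3))
    then show ?thesis by blast
  next
    case False
    then have "filter (\<lambda>(x, u, q). u \<le> t) (sched r \<sigma> (x # xs)) = []"
      using sched_later[OF g og, of _ _ _ r]
      by (fastforce simp: sched_Cons case_prod_beta filter_empty_conv simp del: schedule.simps(2,3))
    then show ?thesis using Cons.prems by (intro exI[of _ "[]"] exI[of _ "x # xs"]) auto
  qed
qed simp

text \<open>
  A picker in situation \<open>\<sigma>'\<close> (a time and a place) can still bring herself into situation \<open>\<sigma>\<close>.
  Performing the same stops preserves this relation, by the triangle inequality.
\<close>

definition ahead :: "real \<times> point \<Rightarrow> real \<times> point \<Rightarrow> bool" where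
  "ahead \<sigma>' \<sigma> \<longleftrightarrow> snd \<sigma>' \<in> grid w \<and> snd \<sigma> \<in> grid w \<and> fst \<sigma>' + gdist w (snd \<sigma>') (snd \<sigma>) \<le> fst \<sigma>"

lemma ahead_refl: "snd \<sigma> \<in> grid w \<Longrightarrow> ahead \<sigma> \<sigma>"
  by (simp add: ahead_def gdist_refl)

lemma ahead_trans: "ahead \<rho> \<sigma> \<Longrightarrow> ahead \<sigma> \<tau> \<Longrightarrow> ahead \<rho> \<tau>"
  using gdist_triangle[of "snd \<rho>" "snd \<sigma>" "snd \<tau>"] by (auto simp: ahead_def)

lemma ahead_le: "ahead \<sigma>' \<sigma> \<Longrightarrow> fst \<sigma>' \<le> fst \<sigma>"
  using gdist_nonneg[of "snd \<sigma>'" "snd \<sigma>"] by (auto simp: ahead_def)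

lemma ahead_after_stop:
  assumes a: "ahead \<sigma>' \<sigma>" and og: "on_grid [x]" and r: "\<And>j s. x = Pick j s \<Longrightarrow> r' j \<le> r j"
  shows "ahead (after_stop r' x \<sigma>') (after_stop r x \<sigma>)"
proof -
  have g: "snd \<sigma>' \<in> grid w" "snd \<sigma> \<in> grid w" using a by (auto simp: ahead_def)
  show ?thesis
  proof (cases x)
    case (Pick j s)
    then have "s \<in> grid w" "r' j \<le> r j" using og r by auto
    then show ?thesis
      using a Pick gdist_triangle[of "snd \<sigma>'" "snd \<sigma>" s] g
      by (auto simp: ahead_def after_stop_def gdist_refl le_max_iff_disj)
  next
    case Finish
    then show ?thesis
      using a gdist_triangle[of "snd \<sigma>'" "snd \<sigma>" "depot w"] g depot_in_grid
      by (auto simp: ahead_def after_stop_def gdist_refl Let_def)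
  qed
qed

lemma ahead_after:
  assumes "ahead \<sigma>' \<sigma>" "on_grid xs" "\<And>j s. Pick j s \<in> set xs \<Longrightarrow> r' j \<le> r j"
  shows "ahead (after r' xs \<sigma>') (after r xs \<sigma>)"
  using assms
proof (induction xs arbitrary: \<sigma>' \<sigma>)
  case (Cons x xs)
  have "r' j \<le> r j" if "x = Pick j s" for j s
    using Cons.prems(3)[of j s] that by simp
  then have "ahead (after_stop r' x \<sigma>') (after_stop r x \<sigma>)"
    using Cons.prems(2) by (intro ahead_after_stop[OF Cons.prems(1)]) auto
  then have "ahead (after r' xs (after_stop r' x \<sigma>')) (after r xs (after_stop r x \<sigma>))"
    by (rule Cons.IH) (metis Cons.prems(2,3) list.set_intros(2))+
  then show ?case by simp
qed simp

text \<open>Once everything has been released, a delay is neither amplified nor made up for.\<close>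

lemma after_shift:
  assumes "snd \<sigma> \<in> grid w" "on_grid xs" "r0 \<le> fst \<sigma>" "0 \<le> \<delta>"
  shows "after (\<lambda>_. r0) xs (fst \<sigma> + \<delta>, snd \<sigma>) =
     (fst (after (\<lambda>_. r0) xs \<sigma>) + \<delta>, snd (after (\<lambda>_. r0) xs \<sigma>))"
  using assms
proof (induction xs arbitrary: \<sigma>)
  case (Cons x xs)
  let ?\<tau> = "after_stop (\<lambda>_. r0) x \<sigma>"
  have g: "snd ?\<tau> \<in> grid w" using Cons.prems by (intro after_stop_in_grid) auto
  have "fst \<sigma> \<le> fst ?\<tau>" using Cons.prems by (intro after_stop_later) auto
  moreover have "after_stop (\<lambda>_. r0) x (fst \<sigma> + \<delta>, snd \<sigma>) = (fst ?\<tau> + \<delta>, snd ?\<tau>)"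
    using Cons.prems gdist_nonneg[of "snd \<sigma>"]
    by (cases x) (auto simp: after_stop_def Let_def add.commute max_absorb1 add_increasing add_increasing2 add.left_commute)
  ultimately show ?case using Cons.IH[OF g] Cons.prems by simp
qed simp

definition batch_end :: "point \<Rightarrow> item list \<Rightarrow> point" where
  "batch_end p b = (if sys = Robot then last (p # map snd b) else depot w)"

definition batch_length :: "point \<Rightarrow> item list \<Rightarrow> real" where
  "batch_length p b = walk p (map snd b) + gdist w (last (p # map snd b)) (batch_end p b)"

lemma after_picks:
  assumes "p \<in> grid w" "snd ` set b \<subseteq> grid w" "r0 \<le> t"
  shows "after (\<lambda>_. r0) (picks b) (t, p) = (t + walk p (map snd b), last (p # map snd b))"
  using assms
proof (induction b arbitrary: t p)
  case (Cons i b)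
  obtain j s where i: "i = (j, s)" by (cases i)
  have "r0 \<le> t + gdist w p s" "s \<in> grid w" using Cons.prems gdist_nonneg[of p s] i by auto
  then show ?case using Cons.IH[of s "t + gdist w p s"] Cons.prems i
    by (auto simp: after_stop_def max_absorb1)
qed simp

lemma after_batch:
  assumes "p \<in> grid w" "snd ` set b \<subseteq> grid w" "r0 \<le> t"
  shows "after (\<lambda>_. r0) (stops [b]) (t, p) = (t + batch_length p b, batch_end p b)"
  using after_picks[OF assms]
  by (simp add: stops_Cons after_stop_def Let_def batch_length_def batch_end_def)

lemma batch_end_in_grid: "p \<in> grid w \<Longrightarrow> snd ` set b \<subseteq> grid w \<Longrightarrow> batch_end p b \<in> grid w"
  using depot_in_grid last_in_grid[of p "map snd b"] by (simp add: batch_end_def)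

end

section \<open>Executing a plan\<close>

lemma execute_append: "execute (xs @ ys) s = execute ys (execute xs s)"
  by (induction xs s rule: execute.induct) auto

lemma execute_Cons: "execute (e # es) s = execute es (execute [e] s)"
  using execute_append[of "[e]" es s] by simp

lemma execute_picked_unchanged:
  "Pick j x \<notin> fst ` set es \<Longrightarrow> picked (execute es s) (j, x) = picked s (j, x)"
  by (induction es s rule: execute.induct) (auto simp: rev_image_eqI)

lemma execute_picked_time:
  assumes "Pick j x \<in> fst ` set es" "\<And>y u q. (y, u, q) \<in> set es \<Longrightarrow> t \<le> u"
  shows "\<exists>u\<ge>t. picked (execute es s) (j, x) = Some u"
  using assms
proof (induction es arbitrary: s)
  case (Cons e es)
  obtain y u q where e: "e = (y, u, q)" by (cases e)
  have u: "t \<le> u" by (rule Cons.prems(2)[of y u q]) (simp add: e)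
  show ?case
  proof (cases "Pick j x \<in> fst ` set es")
    case True
    then have "\<exists>u\<ge>t. picked (execute es s') (j, x) = Some u" for s'
      by (rule Cons.IH) (metis Cons.prems(2) list.set_intros(2))
    then show ?thesis using e by (cases y) auto
  next
    case False
    then have "y = Pick j x" using Cons.prems(1) e by auto
    then show ?thesis using e u execute_picked_unchanged[OF False] by simp
  qed
qed simp

abbreviation disjoint_orders :: "item list \<Rightarrow> item list \<Rightarrow> bool" where
  "disjoint_orders x y \<equiv> orders_of x \<inter> orders_of y = {}"

text \<open>The symmetric condition on pairs of batches becomes one that is compatible with \<open>@\<close>.\<close>

lemma batching_iff:
  "batching c X C bs \<longleftrightarrow>
     bs \<noteq> [] \<and> distinct (concat bs) \<and> set (concat bs) = X \<and> sorted_wrt disjoint_orders bs \<and>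
     card (C \<union> orders_of (hd bs)) \<le> c \<and>
     (\<forall>b \<in> set (tl bs). b \<noteq> [] \<and> card (orders_of b) \<le> c \<and> orders_of b \<inter> C = {}) \<and>
     (C = {} \<and> X \<noteq> {} \<longrightarrow> hd bs \<noteq> [])"
proof -
  have "(\<forall>i<length bs. \<forall>k<length bs. i \<noteq> k \<longrightarrow> orders_of (bs ! i) \<inter> orders_of (bs ! k) = {}) \<longleftrightarrow>
      sorted_wrt disjoint_orders bs"
    unfolding sorted_wrt_iff_nth_less
  proof (intro iffI allI impI)
    fix i k
    assume pw: "\<forall>i k. i < k \<longrightarrow> k < length bs \<longrightarrow> disjoint_orders (bs ! i) (bs ! k)"
      and "i < length bs" "k < length bs" "i \<noteq> k"
    then show "disjoint_orders (bs ! i) (bs ! k)"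
      by (metis Int_commute linorder_neqE_nat)
  qed simp
  then show ?thesis by (simp only: batching_def)
qed

abbreviation situation :: "state \<Rightarrow> real \<times> point" where
  "situation s \<equiv> (clock s, position s)"

locale picking_instance = picking +
  fixes I :: inst
  assumes valid_I: "valid_inst w I"
begin

abbreviation release :: "nat \<Rightarrow> real" where
  "release j \<equiv> snd (I ! j)"

lemma items_known: "items (known I t) = {(j, s) \<in> items I. release j \<le> t}"
proof -
  have sorted: "sorted (map snd I)" using valid_I by (simp add: valid_inst_def)
  let ?k = "length (known I t)"
  have known: "known I t = take ?k I" unfolding known_def by (rule takeWhile_eq_take)
  have k: "?k \<le> length I" unfolding known_def by (rule length_takeWhile_le)
  have less: "j < ?k \<longleftrightarrow> release j \<le> t" if "j < length I" for j
  proof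
    assume "j < ?k"
    then show "release j \<le> t"
      using takeWhile_nth[of j "\<lambda>(ord, r). r \<le> t" I] nth_mem[of j "known I t"]
        set_takeWhileD[of "I ! j" "\<lambda>(ord, r). r \<le> t" I]
      by (auto simp: known_def case_prod_beta)
  next
    assume r: "release j \<le> t"
    show "j < ?k"
    proof (rule ccontr)
      assume "\<not> j < ?k"
      then have "?k \<le> j" by simp
      with that have "release ?k \<le> release j"
        using sorted_nth_mono[OF sorted, of ?k j] by simp
      moreover have "\<not> release ?k \<le> t"
        using nth_length_takeWhile[of "\<lambda>(ord, r). r \<le> t" I] \<open>?k \<le> j\<close> that
        by (simp add: known_def case_prod_beta)
      ultimately show False using r by simp
    qed
  qed
  have nth: "known I t ! j = I ! j" if "j < ?k" for j
    using that k by (subst known) simp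
  have "(j, s) \<in> items (known I t) \<longleftrightarrow> (j, s) \<in> items I \<and> release j \<le> t" for j s
  proof (cases "j < ?k")
    case True
    then have "j < length I" using k by simp
    then show ?thesis using True less[of j] nth[of j] by (simp add: items_def)
  next
    case False
    then show ?thesis using less[of j] by (auto simp: items_def)
  qed
  then show ?thesis by auto
qed

lemma valid_known: "valid_inst w (known I t)"
proof -
  have "known I t = take (length (known I t)) I" unfolding known_def by (rule takeWhile_eq_take)
  then have "map snd (known I t) = take (length (known I t)) (map snd I)" by (metis take_map)
  moreover have "sorted (map snd I)" using valid_I by (simp add: valid_inst_def)
  ultimately have "sorted (map snd (known I t))" using sorted_wrt_take by metis
  moreover have "set (known I t) \<subseteq> set I" unfolding known_def by (auto dest: set_takeWhileD)
  ultimately show ?thesis using valid_I unfolding valid_inst_def by blast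
qed

lemma order_facts:
  assumes "j < length I"
  shows "finite (fst (I ! j))" "fst (I ! j) \<noteq> {}" "fst (I ! j) \<subseteq> aisles w" "0 \<le> release j"
proof -
  have "case I ! j of (ord, r) \<Rightarrow> finite ord \<and> ord \<noteq> {} \<and> ord \<subseteq> aisles w \<and> 0 \<le> r"
    using bspec[OF conjunct1[OF valid_I[unfolded valid_inst_def]] nth_mem[OF assms]] .
  then show "finite (fst (I ! j))" "fst (I ! j) \<noteq> {}" "fst (I ! j) \<subseteq> aisles w" "0 \<le> release j"
    by (simp_all add: case_prod_beta)
qed

lemma items_in_aisles: "snd ` items I \<subseteq> aisles w"
  using order_facts(3) unfolding items_def by fastforce

lemma items_on_grid: "i \<in> items I \<Longrightarrow> snd i \<in> grid w"
  using items_in_aisles aisles_in_grid by auto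

lemma finite_items: "finite (items I)"
proof -
  have "items I = Sigma {..<length I} (\<lambda>j. fst (I ! j))" by (auto simp: items_def)
  then show ?thesis using order_facts(1) by auto
qed

text \<open>
  \<open>B\<close> are the batches finished before state \<open>s\<close> and \<open>b\<close> the items in the current cart. The last
  condition refers to the items of the whole instance, hence it persists when orders arrive. It ensures
  that no order is split between a finished batch and a future one.
\<close>

definition history :: "state \<Rightarrow> item list list \<Rightarrow> item list \<Rightarrow> bool" where
  "history s B b \<longleftrightarrow>
     distinct (concat B @ b) \<and> set (concat B @ b) = dom (picked s) \<and> dom (picked s) \<subseteq> items I \<and>
     cart s = orders_of b \<and> sorted_wrt disjoint_orders (B @ [b]) \<and>
     (\<forall>x \<in> set B. x \<noteq> [] \<and> card (orders_of x) \<le> capacity w) \<and>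
     card (orders_of b) \<le> capacity w \<and>
     fst ` (items I - dom (picked s)) \<inter> fst ` set (concat B) = {}"

text \<open>
  Running the same stops from time \<open>0\<close> with the true release times leads to a situation that is
  ahead of the actual one. In a final state this bounds the cost of an offline solution by the clock.
\<close>

definition sound :: "state \<Rightarrow> item list list \<Rightarrow> item list \<Rightarrow> bool" where
  "sound s B b \<longleftrightarrow> history s B b \<and>
     ahead (after release (stops B @ picks b) (0, depot w)) (situation s)"

text \<open>
  For an empty cart, a batching of the empty set may consist of one empty batch. The last conjunct
  excludes this idle plan, so that finishing a batch never produces an empty batch in the history.
\<close>

definition todo :: "real \<Rightarrow> state \<Rightarrow> item list list \<Rightarrow> bool" where
  "todo \<tau> s bs \<longleftrightarrow> dom (picked s) \<subseteq> items (known I \<tau>) \<and>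
     feasible_batches w (known I \<tau>) s bs \<and> (cart s \<noteq> {} \<or> hd bs \<noteq> [])"

lemma sound_on_grid: "sound s B b \<Longrightarrow> position s \<in> grid w"
  by (simp add: sound_def ahead_def)

lemma todo_on_grid: "todo \<tau> s bs \<Longrightarrow> on_grid (stops bs)"
  using items_on_grid
  by (fastforce simp: todo_def feasible_batches_def batching_def Pick_in_stops items_known)

lemma execute_situation:
  "situation (execute (sched r (situation s) d) s) = after r d (situation s)"
proof (induction d arbitrary: s)
  case (Cons x d)
  let ?s1 = "execute [(x, after_stop r x (situation s))] s"
  have s1: "situation ?s1 = after_stop r x (situation s)"
    by (cases x) (auto simp: after_stop_def Let_def)
  have step: "execute (sched r (situation s) (x # d)) s = execute (sched r (situation ?s1) d) ?s1"
    unfolding sched_Cons s1 by (rule execute_Cons)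
  have "situation (execute (sched r (situation s) (x # d)) s) =
      situation (execute (sched r (situation ?s1) d) ?s1)" by (simp only: step)
  also have "\<dots> = after r d (situation ?s1)" by (rule Cons.IH)
  also have "\<dots> = after r d (after_stop r x (situation s))" by (simp only: s1)
  finally show ?case by (simp only: fold.simps o_apply)
qed simp

lemma execute_sched_append:
  "execute (sched r (situation s) (d @ e)) s =
     execute (sched r (situation (execute (sched r (situation s) d) s)) e)
       (execute (sched r (situation s) d) s)"
  unfolding sched_append execute_append execute_situation ..

lemma sound_todo_pick:
  assumes s: "sound s B b" and t: "todo \<tau> s (((j, p) # b1) # T)" and "\<tau> \<le> r0"
  defines "s1 \<equiv> execute (sched (\<lambda>_. r0) (situation s) [Pick j p]) s"
  shows "sound s1 B (b @ [(j, p)])" "todo \<tau> s1 (b1 # T)"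
proof -
  have h: "history s B b" using s by (simp add: sound_def)
  have bat: "batching (capacity w) (items (known I \<tau>) - dom (picked s)) (cart s) (((j, p) # b1) # T)"
    and sub: "dom (picked s) \<subseteq> items (known I \<tau>)"
    using t by (auto simp: todo_def feasible_batches_def)
  have ip: "(j, p) \<in> items (known I \<tau>)" "(j, p) \<notin> dom (picked s)"
    using bat by (auto simp: batching_iff)
  then have r: "release j \<le> r0" and iI: "(j, p) \<in> items I" and pg: "p \<in> grid w"
    using \<open>\<tau> \<le> r0\<close> items_on_grid[of "(j, p)"] by (auto simp: items_known)
  have c: "cart s1 = insert j (cart s)" and dm: "dom (picked s1) = insert (j, p) (dom (picked s))"
    by (auto simp: s1_def Let_def)
  have "history s1 B (b @ [(j, p)])"
    unfolding history_def
  proof (intro conjI)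
    show "distinct (concat B @ b @ [(j, p)])" using h ip by (auto simp: history_def)
    show "set (concat B @ b @ [(j, p)]) = dom (picked s1)" using h dm by (auto simp: history_def)
    show "dom (picked s1) \<subseteq> items I" using h dm iI by (auto simp: history_def)
    show "cart s1 = orders_of (b @ [(j, p)])" using h c by (auto simp: history_def)
    have "j \<in> fst ` (items I - dom (picked s))" using ip iI by force
    then have "j \<notin> fst ` set (concat B)" using h unfolding history_def by blast
    then have "j \<notin> orders_of x" if "x \<in> set B" for x
      using that by auto
    moreover have "sorted_wrt disjoint_orders B" "\<forall>x \<in> set B. disjoint_orders x b"
      using h by (simp_all add: history_def sorted_wrt_append)
    ultimately show "sorted_wrt disjoint_orders (B @ [b @ [(j, p)]])"
      by (simp add: sorted_wrt_append)
    show "\<forall>x\<in>set B. x \<noteq> [] \<and> card (orders_of x) \<le> capacity w" using h by (auto simp: history_def)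
    have "orders_of (b @ [(j, p)]) \<subseteq> cart s \<union> orders_of ((j, p) # b1)"
      using h by (auto simp: history_def)
    moreover have "finite (cart s)" using h by (simp add: history_def)
    ultimately have "card (orders_of (b @ [(j, p)])) \<le> card (cart s \<union> orders_of ((j, p) # b1))"
      by (intro card_mono) auto
    also have "\<dots> \<le> capacity w" using bat by (simp add: batching_iff)
    finally show "card (orders_of (b @ [(j, p)])) \<le> capacity w" .
    have "fst ` (items I - dom (picked s1)) \<subseteq> fst ` (items I - dom (picked s))"
      unfolding dm by (intro image_mono) auto
    moreover have "fst ` (items I - dom (picked s)) \<inter> fst ` set (concat B) = {}"
      using h by (simp add: history_def)
    ultimately show "fst ` (items I - dom (picked s1)) \<inter> fst ` set (concat B) = {}"
      by (simp only: disjoint_iff subset_iff) metis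
  qed
  moreover have "ahead (after release (stops B @ picks (b @ [(j, p)])) (0, depot w)) (situation s1)"
  proof -
    have "ahead (after_stop release (Pick j p) (after release (stops B @ picks b) (0, depot w)))
        (after_stop (\<lambda>_. r0) (Pick j p) (situation s))"
      using s pg r by (intro ahead_after_stop) (auto simp: sound_def)
    then show ?thesis using execute_situation[of "\<lambda>_. r0" s "[Pick j p]"]
      by (simp add: s1_def del: schedule.simps)
  qed
  ultimately show "sound s1 B (b @ [(j, p)])" by (simp add: sound_def)
  have "batching (capacity w) (items (known I \<tau>) - dom (picked s1)) (cart s1) (b1 # T)"
    using bat unfolding batching_iff c dm by auto
  then show "todo \<tau> s1 (b1 # T)"
    using sub ip c dm by (auto simp: todo_def feasible_batches_def)
qed

lemma sound_todo_finish:
  assumes s: "sound s B b" and t: "todo \<tau> s ([] # T)" and "\<tau> \<le> r0"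
  defines "s1 \<equiv> execute (sched (\<lambda>_. r0) (situation s) [Finish]) s"
  shows "sound s1 (B @ [b]) []"
    "if T = [] then dom (picked s1) = items (known I \<tau>) else todo \<tau> s1 T"
proof -
  have h: "history s B b" using s by (simp add: sound_def)
  have bat: "batching (capacity w) (items (known I \<tau>) - dom (picked s)) (cart s) ([] # T)"
    and sub: "dom (picked s) \<subseteq> items (known I \<tau>)" and ne: "cart s \<noteq> {}"
    using t by (auto simp: todo_def feasible_batches_def)
  have c: "cart s1 = {}" and dm: "picked s1 = picked s"
    by (auto simp: s1_def Let_def)
  have closed: "j \<notin> orders_of b" if "j \<in> fst ` (items I - dom (picked s))" for j
  proof
    assume j: "j \<in> orders_of b"
    have "set b \<subseteq> dom (picked s)"
      using h unfolding history_def by (metis Un_upper2 set_append)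
    then have "j \<in> fst ` items (known I \<tau>)" using j sub by blast
    moreover have "j \<in> cart s" using h j by (simp add: history_def)
    ultimately have "j \<in> fst ` items (known I \<tau>)" "j \<in> cart s" .
    then have "j \<in> fst ` (items (known I \<tau>) - dom (picked s))"
      using that by (force simp: items_known)
    moreover have "items (known I \<tau>) - dom (picked s) = set (concat T)"
      using bat by (auto simp: batching_iff)
    ultimately have "\<exists>x \<in> set T. j \<in> orders_of x" by force
    moreover have "\<forall>x \<in> set T. orders_of x \<inter> cart s = {}"
      using bat by (simp add: batching_iff)
    ultimately show False using \<open>j \<in> cart s\<close> by blast
  qed
  have "fst ` (items I - dom (picked s)) \<inter> fst ` set (concat B) = {}"
    using h by (simp add: history_def)
  then have "fst ` (items I - dom (picked s)) \<inter> fst ` set (concat (B @ [b])) = {}"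
    using closed by (simp add: image_Un Int_Un_distrib) blast
  moreover have "b \<noteq> []" using h ne by (auto simp: history_def)
  moreover have "sorted_wrt disjoint_orders ((B @ [b]) @ [[]])"
    using h by (simp add: history_def sorted_wrt_append)
  ultimately have "history s1 (B @ [b]) []"
    using h unfolding history_def c dm by simp
  moreover have "ahead (after release (stops (B @ [b]) @ picks []) (0, depot w)) (situation s1)"
  proof -
    have "ahead (after_stop release Finish (after release (stops B @ picks b) (0, depot w)))
        (after_stop (\<lambda>_. r0) Finish (situation s))"
      using s by (intro ahead_after_stop) (auto simp: sound_def)
    then show ?thesis using execute_situation[of "\<lambda>_. r0" s "[Finish]"]
      by (simp add: s1_def stops_append stops_Cons del: schedule.simps)
  qed
  ultimately show "sound s1 (B @ [b]) []" by (simp add: sound_def)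
  show "if T = [] then dom (picked s1) = items (known I \<tau>) else todo \<tau> s1 T"
  proof (cases T)
    case Nil
    then show ?thesis using bat sub dm by (auto simp: batching_iff)
  next
    case (Cons b1 T1)
    then show ?thesis
      using bat sub unfolding todo_def feasible_batches_def batching_iff c dm by auto
  qed
qed

text \<open>
  A stop either moves an item from the plan into the cart or moves the contents of the cart to the
  finished batches. Neither affects the batching that history and plan form together, so after any
  prefix \<open>d\<close> of the stops the remaining stops \<open>e\<close> still come from a plan.
\<close>

lemma execute_prefix:
  assumes "sound s B b" "todo \<tau> s bs" "stops bs = d @ e" "\<tau> \<le> r0"
  defines "s' \<equiv> execute (sched (\<lambda>_. r0) (situation s) d) s"
  shows "\<exists>B' b'. sound s' B' b' \<and>
    (if e = [] then cart s' = {} \<and> b' = [] \<and> dom (picked s') = items (known I \<tau>)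
     else (\<exists>bs'. todo \<tau> s' bs' \<and> stops bs' = e))"
  using assms(1-4) unfolding s'_def
proof (induction d arbitrary: s B b bs)
  case Nil
  then have "bs \<noteq> []" by (auto simp: todo_def feasible_batches_def batching_def)
  then have "e \<noteq> []" using Nil by (cases bs) (auto simp: stops_Cons)
  then show ?case using Nil by auto
next
  case (Cons x d)
  let ?s1 = "execute (sched (\<lambda>_. r0) (situation s) [x]) s"
  have exec: "execute (sched (\<lambda>_. r0) (situation s) (x # d)) s =
      execute (sched (\<lambda>_. r0) (situation ?s1) d) ?s1"
    using execute_sched_append[of "\<lambda>_. r0" s "[x]" d] by (simp only: append_Cons append_Nil)
  have "bs \<noteq> []" using Cons.prems by (auto simp: todo_def feasible_batches_def batching_def)
  then obtain b0 T where bs: "bs = b0 # T" by (cases bs) auto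
  show ?case
  proof (cases b0)
    case (Cons i b1)
    obtain j p where i: "i = (j, p)" by (cases i)
    have x: "x = Pick j p" "stops (b1 # T) = d @ e"
      using Cons.prems(3) bs Cons i by (auto simp: stops_Cons)
    show ?thesis unfolding exec
      using Cons.IH[of ?s1 B "b @ [(j, p)]" "b1 # T"] sound_todo_pick[of s B b \<tau> j p b1 T r0]
        Cons.prems bs Cons i x by (simp del: schedule.simps)
  next
    case Nil
    have x: "x = Finish" "stops T = d @ e"
      using Cons.prems(3) bs Nil by (auto simp: stops_Cons)
    note fin = sound_todo_finish[of s B b \<tau> T r0]
    show ?thesis
    proof (cases "T = []")
      case True
      then have de: "d = []" "e = []" using x by auto
      have "cart ?s1 = {}" using x by (simp add: Let_def)
      moreover have "sound ?s1 (B @ [b]) []" "dom (picked ?s1) = items (known I \<tau>)"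
        using fin Cons.prems bs Nil x True by (simp_all del: schedule.simps)
      ultimately show ?thesis unfolding exec de by auto
    next
      case False
      then show ?thesis unfolding exec
        using Cons.IH[of ?s1 "B @ [b]" "[]" T] fin Cons.prems bs Nil x by (simp del: schedule.simps)
    qed
  qed
qed

end

section \<open>Optimal plans have short batches\<close>

lemma single_order_batches:
  fixes X :: "item set"
  assumes "finite X"
  shows "\<exists>bs. distinct (concat bs) \<and> set (concat bs) = X \<and> sorted_wrt disjoint_orders bs \<and>
     (\<forall>b \<in> set bs. b \<noteq> [] \<and> card (orders_of b) = 1)"
proof -
  have "\<exists>bs. distinct (concat bs) \<and> set (concat bs) = X \<and> sorted_wrt disjoint_orders bs \<and>
     (\<forall>b \<in> set bs. b \<noteq> [] \<and> card (orders_of b) = 1)"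
    if "finite J" "fst ` X = J" "finite X" for J and X :: "item set"
    using that
  proof (induction J arbitrary: X)
    case empty
    then show ?case by (intro exI[of _ "[]"]) auto
  next
    case (insert j J)
    let ?Y = "{i \<in> X. fst i \<noteq> j}" and ?Z = "{i \<in> X. fst i = j}"
    have Y: "fst ` ?Y = J" "finite ?Y" using insert.prems insert.hyps(2) by force+
    obtain bs where bs: "distinct (concat bs)" "set (concat bs) = ?Y"
        "sorted_wrt disjoint_orders bs" "\<forall>b \<in> set bs. b \<noteq> [] \<and> card (orders_of b) = 1"
      using insert.IH[OF Y] by blast
    obtain b where b: "distinct b" "set b = ?Z"
      using finite_distinct_list[of ?Z] insert.prems(2) by auto
    have "j \<in> fst ` X" using insert.prems(1) by simp
    then have ob: "orders_of b = {j}" "b \<noteq> []" using b(2) by auto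
    have "j \<notin> fst ` set (concat bs)" using bs(2) by auto
    then have "\<forall>x \<in> set bs. disjoint_orders b x" using ob by auto
    moreover have "set b \<inter> set (concat bs) = {}" using b(2) bs(2) by auto
    moreover have "set b \<union> set (concat bs) = X" using b(2) bs(2) by auto
    ultimately show ?case using bs b ob by (intro exI[of _ "b # bs"]) simp
  qed
  from this[OF finite_imageI[OF assms] refl assms] show ?thesis .
qed

context picking_instance
begin

lemma items_known_subset: "items (known I \<tau>) \<subseteq> items I"
  by (auto simp: items_known)

lemma finite_known: "finite (items (known I \<tau>))"
  using items_known_subset finite_items by (rule finite_subset)

text \<open>
  Finish the orders in the cart first, then give every other order a batch of its own. If the cart is
  empty, the batch for its orders is dropped unless there is no other one.
\<close>

lemma feasible_batches_exist:
  assumes "sound s B b" "dom (picked s) \<subseteq> items (known I \<tau>)"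
  shows "\<exists>bs. feasible_batches w (known I \<tau>) s bs"
proof -
  define X where "X = items (known I \<tau>) - dom (picked s)"
  have finX: "finite X" using finite_known by (simp add: X_def)
  have C: "finite (cart s)" "card (cart s) \<le> capacity w"
    using assms(1) by (auto simp: sound_def history_def)
  have cap: "1 \<le> capacity w" using valid_w by (simp add: valid_warehouse_def)
  obtain b1 where b1: "distinct b1" "set b1 = {i \<in> X. fst i \<in> cart s}"
    using finite_distinct_list[of "{i \<in> X. fst i \<in> cart s}"] finX by auto
  obtain T where T: "distinct (concat T)" "set (concat T) = {i \<in> X. fst i \<notin> cart s}"
      "sorted_wrt disjoint_orders T" "\<forall>x \<in> set T. x \<noteq> [] \<and> card (orders_of x) = 1"
    using single_order_batches[of "{i \<in> X. fst i \<notin> cart s}"] finX by auto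
  have T_cart: "orders_of x \<inter> cart s = {}" if "x \<in> set T" for x
    using T(2) that by auto
  have b1_cart: "orders_of b1 \<subseteq> cart s" using b1(2) by auto
  have "batching (capacity w) X (cart s) (if cart s = {} \<and> T \<noteq> [] then T else b1 # T)"
  proof (cases "cart s = {} \<and> T \<noteq> []")
    case True
    then obtain t T' where "T = t # T'" by (cases T) auto
    then show ?thesis using T True cap by (auto simp: batching_iff)
  next
    case False
    have "cart s \<union> orders_of b1 = cart s" using b1_cart by auto
    moreover have "set b1 \<inter> set (concat T) = {}" "set b1 \<union> set (concat T) = X"
      using b1(2) T(2) by auto
    moreover have "\<forall>x \<in> set T. disjoint_orders b1 x" using T_cart b1_cart by blast
    moreover have "b1 \<noteq> []" if "cart s = {}" "X \<noteq> {}"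
      using that False T(2) by auto
    ultimately show ?thesis using False T b1(1) C cap T_cart by (auto simp: batching_iff)
  qed
  then show ?thesis unfolding feasible_batches_def X_def by blast
qed

lemma plan_completion_eq:
  "plan_completion sys w s bs = fst (after (\<lambda>_. clock s) (stops bs) (situation s))"
  by (simp add: plan_completion_def completion_eq)

lemma feasible_on_grid:
  "feasible_batches w (known I \<tau>) s bs \<Longrightarrow> on_grid (stops bs)"
  using items_on_grid
  by (fastforce simp: feasible_batches_def batching_def Pick_in_stops items_known)

lemma feasible_resequence:
  assumes "feasible_batches w K s (B1 @ b # B2)" "set b' = set b" "distinct b'"
  shows "feasible_batches w K s (B1 @ b' # B2)"
proof -
  have "b' = [] \<longleftrightarrow> b = []" using assms(2) by (metis set_empty)
  then show ?thesis using assms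
    by (cases B1) (simp_all add: feasible_batches_def batching_iff sorted_wrt_append)
qed

text \<open>
  Replacing one batch by a bounded tour through its items would make the plan shorter if the
  batch took longer than \<open>batch_bound\<close>: one \<open>diam\<close> pays for the way back to the depot, the other one
  for moving from the new end of the batch to the old one, which matters for a robot.
\<close>

lemma optimal_batch_length:
  assumes "sound s B b0" and "optimal_plan sys w (known I \<tau>) s \<pi>"
    and bs: "batches \<pi> = B1 @ b # B2"
  shows "batch_length (snd (after (\<lambda>_. clock s) (stops B1) (situation s))) b \<le> batch_bound"
proof (rule ccontr)
  let ?r = "\<lambda>_::nat. clock s"
  define \<sigma> where "\<sigma> = after ?r (stops B1) (situation s)"
  define p where "p = snd \<sigma>"
  define t where "t = fst \<sigma>"
  assume "\<not> ?thesis"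
  then have long: "batch_bound < batch_length p b" by (simp add: p_def \<sigma>_def)
  have feas: "feasible_batches w (known I \<tau>) s (B1 @ b # B2)"
    and opt: "\<And>bs'. feasible_batches w (known I \<tau>) s bs' \<Longrightarrow>
      plan_completion sys w s (B1 @ b # B2) \<le> plan_completion sys w s bs'"
    using assms(2) bs by (auto simp: optimal_plan_def)
  have sub: "set (concat (B1 @ b # B2)) \<subseteq> items I"
    using feas items_known_subset[of \<tau>] by (simp only: feasible_batches_def batching_iff) blast
  then have "set b \<subseteq> items I" by auto
  then have b_aisles: "snd ` set b \<subseteq> aisles w" using items_in_aisles by blast
  have og: "on_grid (stops B1)" "on_grid (stops B2)" "snd ` set b \<subseteq> grid w"
    using feasible_on_grid[OF feas] b_aisles aisles_in_grid
    by (auto simp: stops_append stops_Cons)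
  have pg: "p \<in> grid w" and t: "clock s \<le> t"
    using after_in_grid[of "situation s" "stops B1" ?r] after_later[of "situation s" "stops B1" ?r]
      og(1) sound_on_grid[OF assms(1)] by (auto simp: p_def t_def \<sigma>_def)
  \<comment> \<open>the competitor: the same plan with \<open>b\<close> resequenced as a bounded tour\<close>
  obtain b' where b': "distinct b'" "set b' = set b"
      "\<And>q. q \<in> grid w \<Longrightarrow> walk q (map snd b') \<le> real (card (orders_of b)) * tour_bound"
    using bounded_item_tour[of "set b"] b_aisles by auto
  have "card (orders_of b) \<le> capacity w"
  proof (cases B1)
    case Nil
    have "finite (cart s)" using assms(1) by (simp add: sound_def history_def)
    then have "card (orders_of b) \<le> card (cart s \<union> orders_of b)" by (intro card_mono) auto
    also have "\<dots> \<le> capacity w" using feas Nil by (simp add: feasible_batches_def batching_iff)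
    finally show ?thesis .
  qed (use feas in \<open>simp add: feasible_batches_def batching_iff\<close>)
  then have "real (card (orders_of b)) * tour_bound \<le> real (capacity w) * tour_bound"
    using tour_bound_nonneg by (intro mult_right_mono) auto
  then have walk: "walk p (map snd b') \<le> real (capacity w) * tour_bound"
    using b'(3)[OF pg] by linarith
  have og': "snd ` set b' \<subseteq> grid w" using og(3) b'(2) by simp
  then have e': "batch_end p b' \<in> grid w" by (rule batch_end_in_grid[OF pg])
  have e: "batch_end p b \<in> grid w" using pg og(3) by (rule batch_end_in_grid)
  have "gdist w (last (p # map snd b')) (batch_end p b') \<le> diam"
    by (rule gdist_le_diam[OF last_in_grid[OF pg] e']) (use og' in auto)
  then have short: "batch_length p b' \<le> real (capacity w) * tour_bound + diam"
    using walk by (simp add: batch_length_def)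
  have split: "plan_completion sys w s (B1 @ x # B2) =
      fst (after ?r (stops B2) (t + batch_length p x, batch_end p x))"
    if "snd ` set x \<subseteq> grid w" for x
    using after_batch[OF pg that t]
    by (simp add: plan_completion_eq stops_append stops_Cons \<sigma>_def[symmetric] p_def t_def)
  \<comment> \<open>After time \<open>batch_bound\<close> the competitor could be where \<open>b\<close> ends, so it performs the rest of the
    plan earlier than the optimal plan does.\<close>
  have "ahead (t + batch_length p b', batch_end p b') (t + batch_bound, batch_end p b)"
    using short gdist_le_diam[OF e' e] e e' by (simp add: ahead_def batch_bound_def)
  then have "ahead (after ?r (stops B2) (t + batch_length p b', batch_end p b'))
      (after ?r (stops B2) (t + batch_bound, batch_end p b))"
    by (rule ahead_after) (use og(2) in auto)
  then have "plan_completion sys w s (B1 @ b' # B2) \<le>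
      fst (after ?r (stops B2) (t + batch_bound, batch_end p b))"
    using split[OF og'] ahead_le by metis
  moreover have "plan_completion sys w s (B1 @ b # B2) =
      fst (after ?r (stops B2) (t + batch_bound, batch_end p b)) + (batch_length p b - batch_bound)"
    using split[OF og(3)] long og(2) e t batch_bound_nonneg
      after_shift[of "(t + batch_bound, batch_end p b)" "stops B2" "clock s" "batch_length p b - batch_bound"]
    by simp
  moreover have "plan_completion sys w s (B1 @ b # B2) \<le> plan_completion sys w s (B1 @ b' # B2)"
    by (rule opt) (rule feasible_resequence[OF feas b'(2,1)])
  ultimately show False using long by linarith
qed

section \<open>Orders picked late\<close>

definition late :: "real \<Rightarrow> state \<Rightarrow> nat set" where
  "late R s = {j. \<exists>x u. picked s (j, x) = Some u \<and> R < u}"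

lemma finite_late: "sound s B b \<Longrightarrow> finite (late R s)"
proof -
  assume "sound s B b"
  then have sub: "dom (picked s) \<subseteq> items I" by (simp add: sound_def history_def)
  have "late R s \<subseteq> fst ` items I"
  proof
    fix j assume "j \<in> late R s"
    then obtain x where "(j, x) \<in> dom (picked s)" unfolding late_def by blast
    with sub have "(j, x) \<in> items I" by (rule subsetD)
    then show "j \<in> fst ` items I" by (rule image_eqI[rotated]) simp
  qed
  then show ?thesis using finite_items finite_subset by blast
qed

lemma execute_batch_cart: "cart (execute (sched r \<sigma> (stops [b])) s) = {}"
  by (simp add: stops_Cons sched_append execute_append Let_def)

text \<open>
  The batch that is in progress at time \<open>R\<close>, or starts then, accounts for one \<open>batch_bound\<close>. A batch
  that starts after time \<open>R\<close> starts with an empty cart, hence it picks an order that no earlier batch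
  has touched, and this new late order pays for it.
\<close>

lemma execute_batch:
  assumes s: "sound s B b" and t: "todo \<tau> s (b1 # T)" and r0: "\<tau> \<le> r0" "r0 \<le> clock s"
    and len: "batch_length (position s) b1 \<le> batch_bound"
    and clk: "clock s \<le> R \<or> cart s = {} \<and> clock s \<le> R + batch_bound * (1 + real (card (late R s)))"
  defines "s' \<equiv> execute (sched (\<lambda>_. r0) (situation s) (stops [b1])) s"
  obtains B' where "sound s' B' []" "cart s' = {}"
    "if T = [] then dom (picked s') = items (known I \<tau>) else todo \<tau> s' T"
    "position s' = batch_end (position s) b1"
    "clock s \<le> clock s'" "clock s' \<le> R + batch_bound * (1 + real (card (late R s')))"
    "set b1 \<subseteq> dom (picked s')" "dom (picked s) \<subseteq> dom (picked s')"
proof -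
  have h: "history s B b" using s by (simp add: sound_def)
  have bat: "batching (capacity w) (items (known I \<tau>) - dom (picked s)) (cart s) (b1 # T)"
    and sub: "dom (picked s) \<subseteq> items (known I \<tau>)" and ne: "cart s \<noteq> {} \<or> b1 \<noteq> []"
    using t by (auto simp: todo_def feasible_batches_def)
  have "set (concat (b1 # T)) = items (known I \<tau>) - dom (picked s)"
    using bat by (simp only: batching_iff)
  then have b1_open: "set b1 \<subseteq> items I - dom (picked s)"
    using items_known_subset[of \<tau>] by auto
  have og: "on_grid (stops (b1 # T))" by (rule todo_on_grid[OF t])
  then have og1: "on_grid (stops [b1])" by (simp add: stops_Cons)
  have pg: "position s \<in> grid w" by (rule sound_on_grid[OF s])
  have b1_grid: "snd ` set b1 \<subseteq> grid w" using b1_open items_on_grid by auto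
  have sit: "situation s' = (clock s + batch_length (position s) b1, batch_end (position s) b1)"
    using execute_situation[of "\<lambda>_. r0" s "stops [b1]"] after_batch[OF pg b1_grid r0(2)]
    by (simp add: s'_def)
  have cart: "cart s' = {}" unfolding s'_def by (rule execute_batch_cart)
  have stops: "stops (b1 # T) = stops [b1] @ stops T" by (simp add: stops_Cons)
  obtain B' b' where sound': "sound s' B' b'" and rest:
      "if stops T = [] then cart s' = {} \<and> b' = [] \<and> dom (picked s') = items (known I \<tau>)
       else (\<exists>bs'. todo \<tau> s' bs' \<and> stops bs' = stops T)"
    using execute_prefix[OF s t stops r0(1)] unfolding s'_def by blast
  have "b' = []" using sound' cart by (simp add: sound_def history_def)
  have T: "stops T = [] \<longleftrightarrow> T = []" by (cases T) (auto simp: stops_Cons)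
  have after_start: "fst \<sigma> \<le> u" if "(y, u, q) \<in> set (sched (\<lambda>_. r0) \<sigma> (stops [b1]))"
    "snd \<sigma> \<in> grid w" for y u q \<sigma>
    using sched_later[OF that(2) og1 that(1)] .
  have stops_b1: "Pick j x \<in> fst ` set (sched (\<lambda>_. r0) (situation s) (stops [b1])) \<longleftrightarrow> (j, x) \<in> set b1"
    for j x
    using fst_sched[of "\<lambda>_. r0" "situation s" "stops [b1]"] Pick_in_stops[of j x "[b1]"]
    by (metis concat.simps append_Nil2 image_set)
  have unchanged: "picked s' (j, x) = picked s (j, x)" if "(j, x) \<notin> set b1" for j x
    unfolding s'_def by (rule execute_picked_unchanged) (use that stops_b1 in simp)
  have new: "\<exists>u\<ge>clock s. picked s' (j, x) = Some u" if "(j, x) \<in> set b1" for j x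
    unfolding s'_def
  proof (rule execute_picked_time)
    show "Pick j x \<in> fst ` set (sched (\<lambda>_. r0) (situation s) (stops [b1]))"
      using that stops_b1 by simp
    show "clock s \<le> u" if "(y, u, q) \<in> set (sched (\<lambda>_. r0) (situation s) (stops [b1]))" for y u q
      using after_start[OF that] pg by simp
  qed
  have dom1: "set b1 \<subseteq> dom (picked s')" using new by fastforce
  have dom2: "dom (picked s) \<subseteq> dom (picked s')"
  proof
    fix i assume i: "i \<in> dom (picked s)"
    obtain j x where [simp]: "i = (j, x)" by (cases i)
    have "(j, x) \<notin> set b1" using i b1_open by auto
    then have "picked s' i = picked s i" using unchanged by simp
    then show "i \<in> dom (picked s')" using i by (simp only: domIff) simp
  qed
  have late_mono: "late R s \<subseteq> late R s'"
  proof
    fix j assume "j \<in> late R s"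
    then obtain x u where xu: "picked s (j, x) = Some u" "R < u" by (auto simp: late_def)
    then have "(j, x) \<notin> set b1" using b1_open by auto
    then have "picked s' (j, x) = Some u" using xu(1) unchanged by simp
    then show "j \<in> late R s'" using xu(2) unfolding late_def by blast
  qed
  have fin: "finite (late R s')" by (rule finite_late[OF sound'])
  have "0 \<le> batch_length (position s) b1"
    unfolding batch_length_def using pg b1_grid last_in_grid[OF pg, of "map snd b1"]
    by (intro add_nonneg_nonneg walk_nonneg gdist_nonneg batch_end_in_grid) auto
  then have clk1: "clock s \<le> clock s'" using sit by simp
  have clk2: "clock s' \<le> R + batch_bound * (1 + real (card (late R s')))"
  proof (cases "clock s \<le> R")
    case True
    have "batch_bound * 1 \<le> batch_bound * (1 + real (card (late R s')))"
      using batch_bound_nonneg by (intro mult_left_mono) auto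
    then show ?thesis using sit len True by simp
  next
    case False
    with clk have c0: "cart s = {}" and c: "clock s \<le> R + batch_bound * (1 + real (card (late R s)))"
      by auto
    obtain j x b2 where b1: "b1 = (j, x) # b2" using ne c0 by (cases b1) auto
    then obtain u where "clock s \<le> u" "picked s' (j, x) = Some u" using new[of j x] by auto
    moreover from this have "R < u" using False by simp
    ultimately have "j \<in> late R s'" unfolding late_def by blast
    moreover have "j \<notin> late R s"
    proof
      assume "j \<in> late R s"
      then obtain y where "(j, y) \<in> dom (picked s)" by (auto simp: late_def)
      moreover have "b = []" using h c0 by (simp add: history_def)
      ultimately have "(j, y) \<in> set (concat B)" using h by (simp add: history_def)
      then have "j \<in> fst ` set (concat B)" by force
      moreover have "(j, x) \<in> items I - dom (picked s)" using b1_open b1 by simp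
      then have "j \<in> fst ` (items I - dom (picked s))" by force
      moreover have "fst ` (items I - dom (picked s)) \<inter> fst ` set (concat B) = {}"
        using h by (simp add: history_def)
      ultimately show False by (simp only: disjoint_iff)
    qed
    ultimately have "insert j (late R s) \<subseteq> late R s'" "card (insert j (late R s)) = Suc (card (late R s))"
      using late_mono fin finite_subset[OF late_mono fin] by auto
    then have "Suc (card (late R s)) \<le> card (late R s')" using card_mono[OF fin] by metis
    then have "batch_bound * (1 + real (card (late R s)) + 1) \<le> batch_bound * (1 + real (card (late R s')))"
      using batch_bound_nonneg by (intro mult_left_mono) auto
    then show ?thesis using sit len c by (simp add: algebra_simps)
  qed
  show thesis
  proof (rule that[OF _ cart])
    show "sound s' B' []" using sound' \<open>b' = []\<close> by simp
    show "if T = [] then dom (picked s') = items (known I \<tau>) else todo \<tau> s' T"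
      using rest T stops_inj by (metis (full_types))
    show "position s' = batch_end (position s) b1" using sit by simp
  qed (use clk1 clk2 dom1 dom2 in simp_all)
qed

lemma execute_batches:
  assumes "sound s B b" "todo \<tau> s bs" "\<tau> \<le> r0" "r0 \<le> clock s"
    and "\<And>B1 b B2. bs = B1 @ b # B2 \<Longrightarrow>
      batch_length (snd (after (\<lambda>_. r0) (stops B1) (situation s))) b \<le> batch_bound"
    and "clock s \<le> R \<or> cart s = {} \<and> clock s \<le> R + batch_bound * (1 + real (card (late R s)))"
  defines "s' \<equiv> execute (sched (\<lambda>_. r0) (situation s) (stops bs)) s"
  shows "\<exists>B'. sound s' B' [] \<and> dom (picked s') = items (known I \<tau>) \<and>
    clock s' \<le> R + batch_bound * (1 + real (card (late R s')))"
  using assms(1-6) unfolding s'_def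
proof (induction bs arbitrary: s B b)
  case Nil
  then show ?case by (simp add: todo_def feasible_batches_def batching_def)
next
  case (Cons b1 T)
  let ?s1 = "execute (sched (\<lambda>_. r0) (situation s) (stops [b1])) s"
  have exec: "execute (sched (\<lambda>_. r0) (situation s) (stops (b1 # T))) s =
      execute (sched (\<lambda>_. r0) (situation ?s1) (stops T)) ?s1"
    using execute_sched_append[of "\<lambda>_. r0" s "stops [b1]" "stops T"]
    by (simp only: stops_append[symmetric] append_Cons append_Nil)
  have "batch_length (position s) b1 \<le> batch_bound"
    using Cons.prems(5)[of "[]" b1 T] by simp
  then obtain B' where B': "sound ?s1 B' []" "cart ?s1 = {}"
    "if T = [] then dom (picked ?s1) = items (known I \<tau>) else todo \<tau> ?s1 T"
    "clock s \<le> clock ?s1" "clock ?s1 \<le> R + batch_bound * (1 + real (card (late R ?s1)))"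
    using execute_batch[OF Cons.prems(1-4) _ Cons.prems(6)] by metis
  show ?case
  proof (cases "T = []")
    case True
    then show ?thesis using B' by auto
  next
    case False
    show ?thesis unfolding exec
    proof (rule Cons.IH[OF B'(1)])
      show "todo \<tau> ?s1 T" using B'(3) False by simp
      show "\<tau> \<le> r0" "r0 \<le> clock ?s1" using Cons.prems(3,4) B'(4) by simp_all
      show "batch_length (snd (after (\<lambda>_. r0) (stops B1) (situation ?s1))) x \<le> batch_bound"
        if "T = B1 @ x # B2" for B1 x B2
        using Cons.prems(5)[of "b1 # B1" x B2] that
          stops_append[of "[b1]" B1]
        by (simp only: execute_situation append_Cons append_Nil fold_append o_apply)
      show "clock ?s1 \<le> R \<or> cart ?s1 = {} \<and>
          clock ?s1 \<le> R + batch_bound * (1 + real (card (late R ?s1)))"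
        using B'(2,5) by simp
    qed
  qed
qed

section \<open>Comparison with the offline optimum\<close>

lemma sound_finished_batching:
  assumes s: "sound s B []" and d: "dom (picked s) = items I" and ne: "items I \<noteq> {}"
  shows "batching (capacity w) (items I) {} B"
proof -
  have h: "history s B []" using s by (simp add: sound_def)
  have "set (concat B) = items I" using h d by (simp add: history_def)
  moreover from this ne have "B \<noteq> []" by auto
  moreover from this have "hd B \<in> set B" by simp
  moreover have "x \<in> set B" if "x \<in> set (tl B)" for x using that by (rule list.set_sel(2)[OF \<open>B \<noteq> []\<close>])
  ultimately show ?thesis using h
    unfolding batching_iff history_def by (auto simp: sorted_wrt_append)
qed

lemma completion_after: "completion sys w release 0 (depot w) bs = fst (after release (stops bs) (0, depot w))"
  by (simp add: completion_eq)

lemma batching_items_on_grid: "batching c (items I) C bs \<Longrightarrow> on_grid (stops bs)"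
  using items_on_grid by (fastforce simp: batching_def Pick_in_stops)

lemma release_le_completion:
  assumes "batching c (items I) {} bs" "j < length I"
  shows "release j \<le> completion sys w release 0 (depot w) bs"
proof -
  have og: "on_grid (stops bs)" by (rule batching_items_on_grid[OF assms(1)])
  obtain x where "x \<in> fst (I ! j)" using order_facts(2)[OF assms(2)] by auto
  then have "(j, x) \<in> items I" using assms(2) by (simp add: items_def)
  then have "Pick j x \<in> set (stops bs)"
    using assms(1) by (simp add: Pick_in_stops batching_iff)
  then obtain ys zs where split: "stops bs = ys @ Pick j x # zs" by (meson split_list)
  let ?\<sigma> = "after_stop release (Pick j x) (after release ys (0, depot w))"
  have "release j \<le> fst ?\<sigma>" by (simp add: after_stop_def)
  also have "\<dots> \<le> fst (after release zs ?\<sigma>)"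
    by (rule after_later) (use og split items_on_grid[OF \<open>(j, x) \<in> items I\<close>] in
      \<open>simp_all add: after_stop_def\<close>)
  finally show ?thesis by (simp add: completion_after split)
qed

text \<open>
  The lower bound holds since the last order has an item, which cannot be picked before its release.
  The upper bound holds since the finished batches of a sound state form an offline solution.
\<close>

lemma ciopt_bounds:
  assumes "sound s B []" "dom (picked s) = items I" "I \<noteq> []"
  shows "snd (last I) \<le> ciopt sys w I" "ciopt sys w I \<le> clock s"
proof -
  let ?S = "{bs. batching (capacity w) (items I) {} bs}"
  have j: "length I - 1 < length I" and last: "snd (last I) = release (length I - 1)"
    using assms(3) by (auto simp: last_conv_nth)
  have ne: "items I \<noteq> {}" using order_facts(2)[OF j] j by (auto simp: items_def)
  have B: "B \<in> ?S" using sound_finished_batching[OF assms(1,2) ne] by simp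
  have low: "release (length I - 1) \<le> completion sys w release 0 (depot w) bs" if "bs \<in> ?S" for bs
    using release_le_completion[OF _ j] that by simp
  show "snd (last I) \<le> ciopt sys w I"
    unfolding ciopt_def last by (rule cINF_greatest) (use B low in auto)
  have "ciopt sys w I \<le> completion sys w release 0 (depot w) B"
    unfolding ciopt_def by (rule cINF_lower[OF bdd_belowI2[OF low] B])
  also have "\<dots> \<le> clock s"
    using assms(1) ahead_le by (fastforce simp: sound_def completion_after)
  finally show "ciopt sys w I \<le> clock s" .
qed

end

section \<open>Interventionist reoptimization\<close>

locale reopt_instance = picking_instance +
  fixes rule :: "inst \<Rightarrow> state \<Rightarrow> plan"
  assumes rule: "reopt_rule sys w rule"
begin

lemma rule_optimal:
  assumes "sound s B b" "dom (picked s) \<subseteq> items (known I \<tau>)"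
  shows "optimal_plan sys w (known I \<tau>) s (rule (known I \<tau>) s)"
  using rule feasible_batches_exist[OF assms] valid_known sound_on_grid[OF assms(1)]
  by (simp add: reopt_rule_def)

lemma optimal_todo:
  assumes "optimal_plan sys w (known I \<tau>) s \<pi>" "dom (picked s) \<subseteq> items (known I \<tau>)"
    "\<not> items (known I \<tau>) \<subseteq> dom (picked s)"
  shows "todo \<tau> s (batches \<pi>)"
  using assms by (auto simp: todo_def optimal_plan_def feasible_batches_def batching_iff)

lemma arrival_has_item:
  assumes "t \<in> set (map snd I)"
  obtains j x where "(j, x) \<in> items I" "release j = t"
proof -
  obtain j where j: "j < length I" "release j = t"
    using assms by (auto simp: in_set_conv_nth)
  then obtain x where "x \<in> fst (I ! j)" using order_facts(2) by blast
  then show thesis using j by (intro that[of j x]) (auto simp: items_def)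
qed

lemma new_arrival_open:
  assumes "t \<in> set (map snd I)" "\<tau> < t" "dom (picked s) \<subseteq> items (known I \<tau>)"
  shows "\<not> items (known I t) \<subseteq> dom (picked s)"
proof
  assume sub: "items (known I t) \<subseteq> dom (picked s)"
  obtain j x where jx: "(j, x) \<in> items I" "release j = t" by (rule arrival_has_item[OF assms(1)])
  then have "(j, x) \<in> items (known I t)" by (simp add: items_known)
  then have "(j, x) \<in> items (known I \<tau>)" using sub assms(3) by blast
  then show False using jx(2) assms(2) by (simp add: items_known)
qed

lemma items_known_mono: "\<tau> \<le> t \<Longrightarrow> items (known I \<tau>) \<subseteq> items (known I t)"
  by (auto simp: items_known)

lemma sound_move:
  assumes "sound s B b" "ahead (situation s) (situation s')" "picked s' = picked s" "cart s' = cart s"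
  shows "sound s' B b"
proof -
  have "ahead (after release (stops B @ picks b) (0, depot w)) (situation s')"
    using assms(1,2) unfolding sound_def by (metis ahead_trans)
  moreover have "history s' B b"
    using assms(1) unfolding sound_def history_def assms(3,4) by (elim conjE) (intro conjI)
  ultimately show ?thesis by (simp add: sound_def)
qed

text \<open>
  The interrupted picker has moved along her plan since the last stop, so her displacement is at
  most the time elapsed.
\<close>

lemma sound_advance:
  assumes s: "sound s B b" and f: "follows sys w s \<pi>" and "clock s \<le> t"
    and sub: "dom (picked s) \<subseteq> items (known I \<tau>)" and "\<tau> \<le> clock s"
    and plan: "batches \<pi> = [] \<or> todo \<tau> s (batches \<pi>)"
  shows "\<exists>B' b'. sound (advance sys w t s \<pi>) B' b'"
    "clock (advance sys w t s \<pi>) = t"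
    "dom (picked (advance sys w t s \<pi>)) \<subseteq> items (known I \<tau>)"
proof -
  let ?r = "\<lambda>_::nat. clock s" and ?xs = "stops (batches \<pi>)"
  have ps: "plan_schedule sys w s (batches \<pi>) = sched ?r (situation s) ?xs"
    by (simp add: plan_schedule_def)
  have og: "on_grid ?xs" using plan todo_on_grid by auto
  have pg: "position s \<in> grid w" by (rule sound_on_grid[OF s])
  obtain d e where xs: "?xs = d @ e"
    and fil: "filter (\<lambda>(x, u, q). u \<le> t) (sched ?r (situation s) ?xs) = sched ?r (situation s) d"
    and le: "fst (after ?r d (situation s)) \<le> t"
    using sched_until[of "situation s" ?xs t ?r] pg og \<open>clock s \<le> t\<close> by (metis fst_conv snd_conv)
  define s1 where "s1 = execute (sched ?r (situation s) d) s"
  have adv: "advance sys w t s \<pi> = s1\<lparr>clock := t, position := path \<pi> t\<rparr>"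
    unfolding advance_def ps fil s1_def ..
  have sit: "situation s1 = after ?r d (situation s)"
    unfolding s1_def by (rule execute_situation)
  have "\<exists>B' b'. sound s1 B' b' \<and> dom (picked s1) \<subseteq> items (known I \<tau>)"
    using plan
  proof
    assume "batches \<pi> = []"
    then have "d = []" using xs by simp
    then show ?thesis using s sub by (auto simp: s1_def)
  next
    assume "todo \<tau> s (batches \<pi>)"
    from execute_prefix[OF s this xs \<open>\<tau> \<le> clock s\<close>] show ?thesis
      unfolding s1_def todo_def by (metis subset_refl)
  qed
  then obtain B' b' where s1: "sound s1 B' b'" "dom (picked s1) \<subseteq> items (known I \<tau>)" by blast
  have path_s1: "path \<pi> (clock s1) = position s1"
  proof -
    consider "after ?r d (situation s) = situation s" |
        x where "(x, after ?r d (situation s)) \<in> set (sched ?r (situation s) ?xs)"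
      using after_in_sched[OF xs] by blast
    then show ?thesis
    proof cases
      case 1
      then show ?thesis using sit f by (simp add: follows_def)
    next
      case 2
      then show ?thesis using f unfolding follows_def ps sit[symmetric] by auto
    qed
  qed
  have "clock s \<le> clock s1"
    using after_later[of "situation s" d ?r] pg og xs sit by (metis Un_iff fst_conv set_append snd_conv)
  moreover have "clock s1 \<le> t" using le sit by (metis fst_conv)
  ultimately have "gdist w (position s1) (path \<pi> t) \<le> t - clock s1"
    using f unfolding follows_def path_s1[symmetric] by (intro gdist_along_path) auto
  moreover have "path \<pi> t \<in> grid w" using f \<open>clock s \<le> t\<close> by (auto simp: follows_def)
  ultimately have "ahead (situation s1) (t, path \<pi> t)"
    using sound_on_grid[OF s1(1)] by (simp add: ahead_def)
  then have "sound (advance sys w t s \<pi>) B' b'"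
    by (intro sound_move[OF s1(1)]) (simp_all add: adv)
  then show "\<exists>B' b'. sound (advance sys w t s \<pi>) B' b'" by blast
  show "clock (advance sys w t s \<pi>) = t" "dom (picked (advance sys w t s \<pi>)) \<subseteq> items (known I \<tau>)"
    using s1(2) by (simp_all add: adv)
qed

text \<open>
  \<open>\<tau>\<close> is the time up to which orders are known to the plan, so an order that arrives at time \<open>t\<close> is
  new. At the very beginning any negative \<open>\<tau>\<close> will do, and the plan contains no batch.
\<close>

definition awaiting :: "real \<Rightarrow> state \<Rightarrow> plan \<Rightarrow> bool" where
  "awaiting t s \<pi> \<longleftrightarrow> clock s \<le> t \<and> (\<exists>B b. sound s B b) \<and> follows sys w s \<pi> \<and>
     (\<exists>\<tau>. \<tau> < t \<and> \<tau> \<le> clock s \<and> dom (picked s) \<subseteq> items (known I \<tau>) \<and>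
        (batches \<pi> = [] \<or> todo \<tau> s (batches \<pi>)))"

definition reoptimized :: "real \<Rightarrow> state \<Rightarrow> plan \<Rightarrow> bool" where
  "reoptimized t s \<pi> \<longleftrightarrow> clock s = t \<and> (\<exists>B b. sound s B b) \<and>
     optimal_plan sys w (known I t) s \<pi> \<and> todo t s (batches \<pi>)"

lemma reoptimized_awaiting: "reoptimized t s \<pi> \<Longrightarrow> t < t' \<Longrightarrow> awaiting t' s \<pi>"
  unfolding reoptimized_def awaiting_def
  by (intro conjI exI[of _ t]) (auto simp: optimal_plan_def todo_def)

lemma intervene_reoptimized:
  assumes a: "awaiting t s \<pi>" and t: "t \<in> set (map snd I)"
  shows "\<exists>s' \<pi>'. intervene sys w rule I t (s, \<pi>) = (s', \<pi>') \<and> reoptimized t s' \<pi>'"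
proof -
  obtain \<tau> B b where "\<tau> < t" "\<tau> \<le> clock s" "dom (picked s) \<subseteq> items (known I \<tau>)"
      "batches \<pi> = [] \<or> todo \<tau> s (batches \<pi>)" "sound s B b" "follows sys w s \<pi>" "clock s \<le> t"
    using a unfolding awaiting_def by blast
  note adv = sound_advance[OF this(5,6,7,3,2,4)]
  let ?s = "advance sys w t s \<pi>"
  obtain B' b' where s': "sound ?s B' b'" using adv(1) by blast
  have sub: "dom (picked ?s) \<subseteq> items (known I t)"
    using adv(3) items_known_mono[of \<tau> t] \<open>\<tau> < t\<close> by simp
  have opt: "optimal_plan sys w (known I t) ?s (rule (known I t) ?s)"
    by (rule rule_optimal[OF s' sub])
  have "todo t ?s (batches (rule (known I t) ?s))"
    by (rule optimal_todo[OF opt sub new_arrival_open[OF t \<open>\<tau> < t\<close> adv(3)]])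
  then have "reoptimized t ?s (rule (known I t) ?s)"
    using s' adv(2) opt unfolding reoptimized_def by blast
  then show ?thesis by (simp add: intervene_def Let_def)
qed

lemma fold_intervene:
  assumes "sorted_wrt (<) ts" "ts \<noteq> []" "set ts \<subseteq> set (map snd I)" "awaiting (hd ts) s \<pi>"
  shows "\<exists>s' \<pi>'. fold (intervene sys w rule I) ts (s, \<pi>) = (s', \<pi>') \<and> reoptimized (last ts) s' \<pi>'"
  using assms
proof (induction ts arbitrary: s \<pi>)
  case (Cons t ts)
  obtain s1 \<pi>1 where 1: "intervene sys w rule I t (s, \<pi>) = (s1, \<pi>1)" "reoptimized t s1 \<pi>1"
    using intervene_reoptimized[of t s \<pi>] Cons.prems by auto
  show ?case
  proof (cases "ts = []")
    case True
    then show ?thesis using 1 by simp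
  next
    case False
    then have "t < hd ts" using Cons.prems(1) by simp
    then show ?thesis
      using Cons.IH[of s1 \<pi>1] Cons.prems 1 False reoptimized_awaiting by simp
  qed
qed simp

lemma sound_initial: "sound (initial w) [] []"
  using depot_in_grid by (simp add: sound_def history_def initial_def ahead_refl)

lemma awaiting_initial:
  assumes "0 \<le> t"
  shows "awaiting t (initial w) \<lparr>batches = [], path = \<lambda>_. depot w\<rparr>"
proof -
  have "follows sys w (initial w) \<lparr>batches = [], path = \<lambda>_. depot w\<rparr>"
    using depot_in_grid
    by (auto simp: follows_def initial_def plan_schedule_def intro!: lipschitz_onI)
  moreover have "-1 < t \<and> -1 \<le> clock (initial w) \<and> dom (picked (initial w)) \<subseteq> items (known I (-1))"
    using assms by (simp add: initial_def)
  ultimately show ?thesis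
    using sound_initial assms unfolding awaiting_def
    by (intro conjI exI[of _ "-1"]) (auto simp: initial_def)
qed

lemma release_le_last:
  assumes "j < length I"
  shows "release j \<le> snd (last I)"
proof -
  have "sorted (map snd I)" using valid_I by (simp add: valid_inst_def)
  moreover have "I \<noteq> []" using assms by auto
  ultimately show ?thesis
    using assms sorted_nth_mono[of "map snd I" j "length I - 1"] by (simp add: last_conv_nth)
qed

lemma items_known_last: "items (known I (snd (last I))) = items I"
proof -
  have "release j \<le> snd (last I)" if "(j, x) \<in> items I" for j x
    using that release_le_last by (simp add: items_def)
  then show ?thesis by (auto simp: items_known)
qed

lemma arrival_bounds:
  assumes "t \<in> set (map snd I)"
  shows "0 \<le> t" "t \<le> snd (last I)"
proof -
  obtain j where "j < length I" "release j = t"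
    using assms by (auto simp: in_set_conv_nth)
  then show "0 \<le> t" "t \<le> snd (last I)" using order_facts(4) release_le_last by blast+
qed

text \<open>What both kinds of reoptimization have to establish; the rest of the argument is common to them.\<close>

definition completed :: "real \<Rightarrow> state \<Rightarrow> bool" where
  "completed R s \<longleftrightarrow> (\<exists>B. sound s B []) \<and> dom (picked s) = items I \<and>
     clock s \<le> R + batch_bound * (1 + real (card (late R s)))"

lemma run_interventionist_completed:
  assumes "I \<noteq> []"
  shows "completed (snd (last I)) (run_interventionist sys w rule I)"
proof -
  let ?R = "snd (last I)" and ?ts = "sorted_list_of_set (set (map snd I))"
  have ts: "set ?ts = set (map snd I)" "sorted_wrt (<) ?ts" "?ts \<noteq> []"
    using assms strict_sorted_list_of_set by (auto simp: sorted_list_of_set_eq_Nil_iff)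
  have "0 \<le> hd ?ts"
  proof -
    have "hd ?ts \<in> set (map snd I)" using hd_in_set[OF ts(3)] ts(1) by simp
    then show ?thesis by (rule arrival_bounds)
  qed
  then obtain s \<pi> where run: "fold (intervene sys w rule I) ?ts
      (initial w, \<lparr>batches = [], path = \<lambda>_. depot w\<rparr>) = (s, \<pi>)" "reoptimized (last ?ts) s \<pi>"
    using fold_intervene[OF ts(2,3) _ awaiting_initial] ts(1) by auto
  have "last ?ts = ?R"
  proof (rule antisym)
    have "last ?ts \<in> set (map snd I)" using last_in_set[OF ts(3)] ts(1) by simp
    then show "last ?ts \<le> ?R" by (rule arrival_bounds)
    have "?R \<in> set ?ts" using assms ts(1) by simp
    then obtain k where "k < length ?ts" "?ts ! k = ?R" by (metis in_set_conv_nth)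
    then show "?R \<le> last ?ts"
      using sorted_nth_mono[of ?ts k "length ?ts - 1"] ts(3) by (simp add: last_conv_nth)
  qed
  then have "reoptimized ?R s \<pi>" using run(2) by simp
  then obtain B b where s: "sound s B b" "clock s = ?R" "optimal_plan sys w (known I ?R) s \<pi>"
      "todo ?R s (batches \<pi>)"
    unfolding reoptimized_def by blast
  let ?s = "execute (sched (\<lambda>_. clock s) (situation s) (stops (batches \<pi>))) s"
  have "\<exists>B'. sound ?s B' [] \<and> dom (picked ?s) = items (known I ?R) \<and>
      clock ?s \<le> ?R + batch_bound * (1 + real (card (late ?R ?s)))"
    by (rule execute_batches[OF s(1,4)]) (use s(2) optimal_batch_length[OF s(1,3)] in auto)
  moreover have "run_interventionist sys w rule I = ?s"
    unfolding run_interventionist_def run(1) by (simp add: plan_schedule_def)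
  ultimately show ?thesis by (simp add: completed_def items_known_last)
qed

end

section \<open>Non-interventionist reoptimization\<close>

context reopt_instance
begin

lemma snd_after_stops:
  assumes "sys \<noteq> Robot" "snd \<sigma> = depot w"
  shows "snd (after r (stops bs) \<sigma>) = depot w"
proof (cases bs rule: rev_cases)
  case (snoc bs' b)
  then show ?thesis using assms(1)
    by (simp add: stops_append stops_Cons after_stop_def Let_def)
qed (use assms in simp)

definition open_orders :: "state \<Rightarrow> nat set" where
  "open_orders s = fst ` (items I - dom (picked s))"

lemma finite_open_orders: "finite (open_orders s)"
  using finite_items by (simp add: open_orders_def)

lemma card_open_orders: "card (open_orders s) \<le> length I"
proof -
  have "open_orders s \<subseteq> {..<length I}" by (auto simp: open_orders_def items_def)
  then show ?thesis using card_mono[of "{..<length I}"] by simp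
qed

text \<open>
  Plans computed earlier remain in use as long as nothing arrives. Since with a pushcart every batch
  starts at the depot, the bound on its length does not depend on when it is started.
\<close>

definition between_batches :: "real \<Rightarrow> state \<times> item list list \<times> inst \<Rightarrow> bool" where
  "between_batches R = (\<lambda>(s, bs, K). \<exists>B \<tau>. sound s B [] \<and> position s = depot w \<and>
     K = known I \<tau> \<and> \<tau> \<le> clock s \<and> dom (picked s) \<subseteq> items K \<and>
     (items K \<subseteq> dom (picked s) \<or>
        todo \<tau> s bs \<and> (\<forall>b \<in> set bs. batch_length (depot w) b \<le> batch_bound)) \<and>
     clock s \<le> R + batch_bound * (1 + real (card (late R s))))"

lemma between_batches_initial:
  assumes "0 \<le> R"
  shows "between_batches R (initial w, [], [])"
proof -
  have "release 0 \<ge> 0" if "I \<noteq> []" using order_facts(4)[of 0] that by simp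
  \<comment> \<open>no order is known yet at time \<open>-1\<close>, while orders released at time \<open>0\<close> are known at time \<open>0\<close>\<close>
  then have "known I (-1) = []"
    by (cases I) (auto simp: known_def case_prod_beta)
  moreover have "0 \<le> R + batch_bound * (1 + real (card (late R (initial w))))"
    using assms batch_bound_nonneg by simp
  ultimately show ?thesis
    using sound_initial unfolding between_batches_def prod.case
    by (intro exI[of _ "[]"] exI[of _ "-1"]) (auto simp: initial_def items_def)
qed

text \<open>
  Whether the picker leaves the depot at once or waits for an arrival, there is something to pick
  when she leaves, and she never waits beyond the last arrival.
\<close>

lemma next_departure:
  fixes s :: state
  assumes dom: "dom (picked s) \<subseteq> items (known I \<tau>)" "\<tau> \<le> clock s"
    and unfinished: "\<not> items I \<subseteq> dom (picked s)"
  defines "t \<equiv> if items (known I (clock s)) \<subseteq> dom (picked s)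
                then Min {r \<in> set (map snd I). clock s < r} else clock s"
  shows "clock s \<le> t" "\<not> items (known I t) \<subseteq> dom (picked s)" "t \<le> snd (last I) \<or> t = clock s"
proof -
  let ?S = "{r \<in> set (map snd I). clock s < r}"
  have "clock s \<le> t \<and> \<not> items (known I t) \<subseteq> dom (picked s) \<and> (t \<le> snd (last I) \<or> t = clock s)"
  proof (cases "items (known I (clock s)) \<subseteq> dom (picked s)")
    case True
    then have t: "t = Min ?S" by (simp add: t_def)
    obtain j x where jx: "(j, x) \<in> items I" "(j, x) \<notin> dom (picked s)" using unfinished by auto
    then have "(j, x) \<notin> items (known I (clock s))" using True by blast
    then have "clock s < release j" using jx(1) by (simp add: items_known)
    moreover have "release j \<in> set (map snd I)" using jx(1) by (auto simp: items_def)
    ultimately have "?S \<noteq> {}" by blast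
    then have "t \<in> ?S" unfolding t by (intro Min_in) auto
    then have "clock s < t" "t \<in> set (map snd I)" by auto
    moreover have "\<not> items (known I t) \<subseteq> dom (picked s)"
      by (rule new_arrival_open[OF \<open>t \<in> set (map snd I)\<close> _ dom(1)]) (use dom(2) \<open>clock s < t\<close> in simp)
    ultimately show ?thesis using arrival_bounds by simp
  qed (simp add: t_def)
  then show "clock s \<le> t" "\<not> items (known I t) \<subseteq> dom (picked s)" "t \<le> snd (last I) \<or> t = clock s"
    by auto
qed

text \<open>
  As long as items are open, every step closes at least one order, which is why \<open>length I\<close> steps
  complete the run.
\<close>

lemma noninterventionist_step_progress:
  assumes sys: "sys \<noteq> Robot" and st: "between_batches (snd (last I)) (s, bs, K)"
    and unfinished: "\<not> items I \<subseteq> dom (picked s)"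
  shows "\<exists>s' bs' K'. noninterventionist_step sys w rule I (s, bs, K) = (s', bs', K') \<and>
     between_batches (snd (last I)) (s', bs', K') \<and> card (open_orders s') < card (open_orders s)"
proof -
  let ?R = "snd (last I)"
  obtain B \<tau> where s: "sound s B []" and pos: "position s = depot w" and K: "K = known I \<tau>"
    and \<tau>: "\<tau> \<le> clock s" and sub: "dom (picked s) \<subseteq> items (known I \<tau>)"
    and plan: "items (known I \<tau>) \<subseteq> dom (picked s) \<or>
        todo \<tau> s bs \<and> (\<forall>b \<in> set bs. batch_length (depot w) b \<le> batch_bound)"
    and clk: "clock s \<le> ?R + batch_bound * (1 + real (card (late ?R s)))"
    using st unfolding between_batches_def by blast
  define t where "t = (if items (known I (clock s)) \<subseteq> dom (picked s)
                then Min {r \<in> set (map snd I). clock s < r} else clock s)"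
  note t = next_departure[OF sub \<tau> unfinished, folded t_def]
  define s1 where "s1 = s\<lparr>clock := t\<rparr>"
  have s1_simps: "clock s1 = t" "position s1 = depot w" "picked s1 = picked s" "cart s1 = cart s"
    using pos by (simp_all add: s1_def)
  have "ahead (situation s) (situation s1)"
    using t(1) depot_in_grid pos by (simp add: s1_simps ahead_def gdist_refl)
  then have sound1: "sound s1 B []"
    by (intro sound_move[OF s]) (simp_all add: s1_simps)
  have cart: "cart s = {}" using s by (simp add: sound_def history_def)
  have sub1: "dom (picked s1) \<subseteq> items (known I t)"
    using sub items_known_mono[of \<tau> t] \<tau> t(1) by (simp add: s1_simps)
  define bs1 where "bs1 = (if known I t = K then bs else batches (rule (known I t) s1))"
  have bs1: "todo t s1 bs1 \<and> (\<forall>b \<in> set bs1. batch_length (depot w) b \<le> batch_bound)"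
  proof (cases "known I t = K")
    case True
    then have "todo \<tau> s bs \<and> (\<forall>b \<in> set bs. batch_length (depot w) b \<le> batch_bound)"
      using plan t(2) K by simp
    then show ?thesis using True K
      by (simp add: bs1_def todo_def feasible_batches_def s1_simps)
  next
    case False
    have opt: "optimal_plan sys w (known I t) s1 (rule (known I t) s1)"
      by (rule rule_optimal[OF sound1 sub1])
    have "todo t s1 (batches (rule (known I t) s1))"
      by (rule optimal_todo[OF opt sub1]) (use t(2) in \<open>simp add: s1_simps\<close>)
    moreover have "batch_length (depot w) b \<le> batch_bound"
      if b: "b \<in> set (batches (rule (known I t) s1))" for b
    proof -
      obtain B1 B2 where B: "batches (rule (known I t) s1) = B1 @ b # B2"
        using split_list[OF b] by blast
      show ?thesis
        using optimal_batch_length[OF sound1 opt B]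
          snd_after_stops[OF sys, of "situation s1" "\<lambda>_. clock s1" B1] by (simp add: s1_simps)
    qed
    ultimately show ?thesis using False by (simp add: bs1_def)
  qed
  then obtain b1 T where bT: "bs1 = b1 # T"
    by (cases bs1) (auto simp: todo_def feasible_batches_def batching_def)
  have todo1: "todo t s1 (b1 # T)" using bs1 bT by simp
  let ?s' = "execute (sched (\<lambda>_. t) (situation s1) (stops [b1])) s1"
  have late: "late ?R s1 = late ?R s" by (simp add: late_def s1_simps)
  obtain B' where B': "sound ?s' B' []" "cart ?s' = {}"
    "if T = [] then dom (picked ?s') = items (known I t) else todo t ?s' T"
    "position ?s' = batch_end (position s1) b1"
    "clock s1 \<le> clock ?s'" "clock ?s' \<le> ?R + batch_bound * (1 + real (card (late ?R ?s')))"
    "set b1 \<subseteq> dom (picked ?s')" "dom (picked s1) \<subseteq> dom (picked ?s')"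
  proof (rule execute_batch[OF sound1 todo1 order_refl, of ?R])
    show "t \<le> clock s1" by (simp add: s1_simps)
    show "batch_length (position s1) b1 \<le> batch_bound" using bs1 bT by (simp add: s1_simps)
    show "clock s1 \<le> ?R \<or>
        cart s1 = {} \<and> clock s1 \<le> ?R + batch_bound * (1 + real (card (late ?R s1)))"
      using t(3) clk cart by (auto simp: s1_simps late)
  qed
  have step: "noninterventionist_step sys w rule I (s, bs, K) = (?s', T, known I t)"
    unfolding noninterventionist_step_def prod.case if_not_P[OF unfinished] Let_def
      t_def[symmetric] s1_def[symmetric] bs1_def[symmetric] bT
    by (simp add: plan_schedule_def s1_simps)
  have dom': "dom (picked ?s') \<subseteq> items (known I t)"
    using B'(3) by (cases "T = []") (auto simp: todo_def)
  have "between_batches ?R (?s', T, known I t)"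
    unfolding between_batches_def prod.case
  proof (intro exI[of _ B'] exI[of _ t] conjI)
    show "position ?s' = depot w" using B'(4) sys by (simp add: batch_end_def)
    show "t \<le> clock ?s'" using B'(5) by (simp add: s1_simps)
    show "items (known I t) \<subseteq> dom (picked ?s') \<or>
        todo t ?s' T \<and> (\<forall>b\<in>set T. batch_length (depot w) b \<le> batch_bound)"
      using B'(3) bs1 bT by (cases "T = []") auto
  qed (use B'(1,6) dom' in simp_all)
  moreover have "card (open_orders ?s') < card (open_orders s)"
  proof (rule psubset_card_mono[OF finite_open_orders])
    have "open_orders ?s' \<subseteq> open_orders s"
      unfolding open_orders_def by (intro image_mono) (use B'(8) s1_simps(3) in auto)
    moreover have "b1 \<noteq> []" using todo1 cart by (simp add: todo_def s1_simps)
    then obtain j x b2 where b1: "b1 = (j, x) # b2" by (cases b1) auto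
    have "set (concat (b1 # T)) = items (known I t) - dom (picked s1)"
      using todo1 by (simp only: todo_def feasible_batches_def batching_iff)
    then have "(j, x) \<in> items I - dom (picked s)"
      using b1 items_known_subset[of t] s1_simps(3) by auto
    then have "j \<in> open_orders s" unfolding open_orders_def by (rule image_eqI[rotated]) simp
    moreover have "j \<notin> open_orders ?s'"
    proof -
      have h: "history ?s' B' []" using B'(1) by (simp add: sound_def)
      have "(j, x) \<in> dom (picked ?s')" using B'(7) unfolding b1 by (rule subsetD) simp
      moreover have "set (concat B') = dom (picked ?s')"
        using h unfolding history_def by (metis append_Nil2)
      ultimately have "(j, x) \<in> set (concat B')" by simp
      then have "j \<in> fst ` set (concat B')" by (rule image_eqI[rotated]) simp
      moreover have "open_orders ?s' \<inter> fst ` set (concat B') = {}"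
        using h unfolding history_def open_orders_def by (elim conjE)
      ultimately show ?thesis by (simp only: disjoint_iff) blast
    qed
    ultimately show "open_orders ?s' \<subset> open_orders s" by blast
  qed
  ultimately show ?thesis using step by blast
qed

lemma run_noninterventionist_completed:
  assumes sys: "sys \<noteq> Robot" and "I \<noteq> []"
  shows "completed (snd (last I)) (run_noninterventionist sys w rule I)"
proof -
  let ?R = "snd (last I)" and ?step = "noninterventionist_step sys w rule I"
  have "?R \<in> set (map snd I)" using \<open>I \<noteq> []\<close> by simp
  then have R: "0 \<le> ?R" by (rule arrival_bounds)
  have iter: "\<exists>s bs K. (?step ^^ k) (initial w, [], []) = (s, bs, K) \<and>
      between_batches ?R (s, bs, K) \<and> card (open_orders s) \<le> length I - k" for k
  proof (induction k)
    case 0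
    then show ?case using between_batches_initial[OF R] card_open_orders by simp
  next
    case (Suc k)
    then obtain s bs K where k: "(?step ^^ k) (initial w, [], []) = (s, bs, K)"
        "between_batches ?R (s, bs, K)" "card (open_orders s) \<le> length I - k" by blast
    have Suc_k: "(?step ^^ Suc k) (initial w, [], []) = ?step (s, bs, K)" using k(1) by simp
    show ?case
    proof (cases "items I \<subseteq> dom (picked s)")
      case True
      then have "?step (s, bs, K) = (s, bs, K)" by (simp add: noninterventionist_step_def)
      moreover have "open_orders s = {}" using True by (auto simp: open_orders_def)
      ultimately show ?thesis using k Suc_k by simp
    next
      case False
      show ?thesis
        using noninterventionist_step_progress[OF sys k(2) False] k(3) unfolding Suc_k by fastforce
    qed
  qed
  obtain s bs K where run: "(?step ^^ length I) (initial w, [], []) = (s, bs, K)"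
    and st: "between_batches ?R (s, bs, K)" and "card (open_orders s) \<le> 0"
    using iter[of "length I"] by auto
  then have "open_orders s = {}" using finite_open_orders by simp
  then have "items I \<subseteq> dom (picked s)" by (simp add: open_orders_def)
  moreover obtain B where "sound s B []" "clock s \<le> ?R + batch_bound * (1 + real (card (late ?R s)))"
    using st unfolding between_batches_def by blast
  moreover from this have "dom (picked s) \<subseteq> items I" by (simp add: sound_def history_def)
  ultimately have "completed ?R s" unfolding completed_def by blast
  then show ?thesis by (simp add: run_noninterventionist_def run)
qed

section \<open>Reopt against the offline optimum\<close>

text \<open>Orders picked late have arrived by \<open>R\<close>, because there are no arrivals after \<open>R\<close>.\<close>

lemma late_pending:
  assumes "completed R (reopt_run sys w rule I)" "snd (last I) \<le> R"
  shows "late R (reopt_run sys w rule I) \<subseteq> pending sys w rule I R"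
proof
  let ?s = "reopt_run sys w rule I"
  fix j assume "j \<in> late R ?s"
  then obtain x u where xu: "picked ?s (j, x) = Some u" "R < u" unfolding late_def by blast
  then have "(j, x) \<in> items I" using assms(1) by (auto simp: completed_def)
  then have "j < length I" "x \<in> fst (I ! j)" by (auto simp: items_def)
  moreover from this have "release j \<le> R" using release_le_last assms(2) by fastforce
  ultimately show "j \<in> pending sys w rule I R"
    using xu unfolding pending_def by (intro CollectI conjI bexI[of _ x]) auto
qed

lemma reopt_close_to_ciopt:
  assumes "I \<noteq> []"
  defines "R \<equiv> snd (last I)"
  shows "R \<le> ciopt sys w I" "ciopt sys w I \<le> reopt sys w rule I"
    "reopt sys w rule I \<le> R + batch_bound * (1 + real (card (pending sys w rule I R)))"
proof -
  let ?s = "reopt_run sys w rule I"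
  have c: "completed R ?s"
    using run_noninterventionist_completed[OF _ assms(1)] run_interventionist_completed[OF assms(1)]
    by (cases sys) (simp_all add: reopt_run_def R_def)
  then obtain B where B: "sound ?s B []" "dom (picked ?s) = items I"
      "clock ?s \<le> R + batch_bound * (1 + real (card (late R ?s)))"
    unfolding completed_def by blast
  show "R \<le> ciopt sys w I" "ciopt sys w I \<le> reopt sys w rule I"
    using ciopt_bounds[OF B(1,2) assms(1)] by (simp_all add: R_def reopt_def)
  have "finite (pending sys w rule I R)" by (simp add: pending_def)
  then have "card (late R ?s) \<le> card (pending sys w rule I R)"
    using late_pending[OF c] by (intro card_mono) (simp_all add: R_def)
  then have "batch_bound * (1 + real (card (late R ?s))) \<le>
      batch_bound * (1 + real (card (pending sys w rule I R)))"
    using batch_bound_nonneg by (intro mult_left_mono) auto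
  then show "reopt sys w rule I \<le> R + batch_bound * (1 + real (card (pending sys w rule I R)))"
    using B(3) by (simp add: reopt_def)
qed

end

section \<open>Poisson arrivals\<close>

text \<open>
  Multiplied by \<open>exp (- x)\<close>, the density of rate \<open>rate\<close> becomes a multiple of the density of
  rate \<open>rate + 1\<close>.
\<close>

lemma nn_integral_exp_exponential:
  assumes "0 < rate" "distributed M lborel X (exponential_density rate)"
  shows "(\<integral>\<^sup>+\<omega>. ennreal (exp (- X \<omega>)) \<partial>M) = ennreal (rate / (rate + 1))"
proof -
  interpret E: prob_space "density lborel (exponential_density (rate + 1))"
    using assms(1) by (intro prob_space_exponential_density) simp
  have pointwise: "ennreal (exponential_density rate x) * ennreal (exp (- x)) =
      ennreal (rate / (rate + 1)) * ennreal (exponential_density (rate + 1) x)" for x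
  proof -
    have "exponential_density rate x * exp (- x) =
        rate / (rate + 1) * exponential_density (rate + 1) x"
      using assms(1) by (simp add: exponential_density_def exp_add[symmetric] distrib_left mult.commute)
    then show ?thesis
      using assms(1) by (simp add: ennreal_mult'[symmetric] exponential_density_nonneg)
  qed
  have "(\<integral>\<^sup>+\<omega>. ennreal (exp (- X \<omega>)) \<partial>M) =
      (\<integral>\<^sup>+x. ennreal (exponential_density rate x) * ennreal (exp (- x)) \<partial>lborel)"
    using distributed_nn_integral[OF assms(2), of "\<lambda>x. ennreal (exp (- x))"] by simp
  also have "\<dots> = ennreal (rate / (rate + 1)) * (\<integral>\<^sup>+x. ennreal (exponential_density (rate + 1) x) \<partial>lborel)"
    unfolding pointwise by (simp add: nn_integral_cmult)
  also have "(\<integral>\<^sup>+x. ennreal (exponential_density (rate + 1) x) \<partial>lborel) = 1"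
    using E.emeasure_space_1 by (simp add: emeasure_density)
  finally show ?thesis by simp
qed

text \<open>
  An exponential moment bound suffices: \<open>exp (- R\<^sub>n)\<close> has expectation \<open>q ^ n\<close> with \<open>q < 1\<close>,
  so for small \<open>\<epsilon>\<close> the expectations of \<open>exp (\<epsilon> n - R\<^sub>n)\<close> form a geometric series. Almost surely the
  terms themselves then tend to \<open>0\<close>.
\<close>

lemma (in prob_space) exponential_partial_sums_linear:
  fixes X :: "nat \<Rightarrow> 'a \<Rightarrow> real"
  assumes "0 < rate" "\<And>j. distributed M lborel (X j) (exponential_density rate)"
    and indep: "indep_vars (\<lambda>_. borel) X UNIV"
  shows "\<exists>\<epsilon>>0. AE \<omega> in M. eventually (\<lambda>n. \<epsilon> * real n \<le> (\<Sum>i<n. X i \<omega>)) sequentially"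
proof -
  define q where "q = rate / (rate + 1)"
  have q: "0 < q" "q < 1" using assms(1) by (auto simp: q_def)
  \<comment> \<open>any \<open>\<epsilon>\<close> with \<open>exp \<epsilon> * q < 1\<close> would do; this one makes the product \<open>sqrt q\<close>\<close>
  define \<epsilon> where "\<epsilon> = - ln q / 2"
  have \<epsilon>: "0 < \<epsilon>" using q by (simp add: \<epsilon>_def)
  define \<rho> where "\<rho> = exp \<epsilon> * q"
  have "\<rho> = exp (\<epsilon> + ln q)" using q by (simp add: \<rho>_def exp_add)
  also have "\<dots> = exp (- \<epsilon>)" by (simp add: \<epsilon>_def)
  finally have \<rho>: "0 < \<rho>" "\<rho> < 1" using \<epsilon> by auto
  define f where "f = (\<lambda>n \<omega>. exp (\<epsilon> * real n - (\<Sum>i<n. X i \<omega>)))"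
  have [measurable]: "X j \<in> borel_measurable M" for j
    using distributed_measurable[OF assms(2)[of j]] by simp
  have meas: "(\<lambda>\<omega>. ennreal (f n \<omega>)) \<in> borel_measurable M" for n
    unfolding f_def by measurable
  have int: "(\<integral>\<^sup>+\<omega>. ennreal (f n \<omega>) \<partial>M) = ennreal (\<rho> ^ n)" for n
  proof -
    have "indep_vars (\<lambda>_. borel) (\<lambda>i \<omega>. ennreal (exp (- X i \<omega>))) {..<n}"
      by (rule indep_vars_compose2[OF indep_vars_subset[OF indep]]) auto
    then have "(\<integral>\<^sup>+\<omega>. (\<Prod>i<n. ennreal (exp (- X i \<omega>))) \<partial>M) =
        (\<Prod>i<n. \<integral>\<^sup>+\<omega>. ennreal (exp (- X i \<omega>)) \<partial>M)"
      by (intro indep_vars_nn_integral) auto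
    also have "\<dots> = ennreal (q ^ n)"
      using q by (simp add: nn_integral_exp_exponential[OF assms(1,2)] q_def[symmetric] ennreal_power)
    finally have prod: "(\<integral>\<^sup>+\<omega>. (\<Prod>i<n. ennreal (exp (- X i \<omega>))) \<partial>M) = ennreal (q ^ n)" .
    have "ennreal (f n \<omega>) = ennreal (exp \<epsilon> ^ n) * (\<Prod>i<n. ennreal (exp (- X i \<omega>)))" for \<omega>
      by (simp add: f_def exp_diff exp_minus exp_sum prod_ennreal ennreal_mult'[symmetric]
          divide_inverse prod_inversef[symmetric] comp_def exp_of_nat2_mult)
    then have "(\<integral>\<^sup>+\<omega>. ennreal (f n \<omega>) \<partial>M) = ennreal (exp \<epsilon> ^ n) * ennreal (q ^ n)"
      using prod by (simp add: nn_integral_cmult)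
    then show ?thesis using q by (simp add: \<rho>_def power_mult_distrib ennreal_mult'[symmetric])
  qed
  have "(\<integral>\<^sup>+\<omega>. (\<Sum>n. ennreal (f n \<omega>)) \<partial>M) = (\<Sum>n. ennreal (\<rho> ^ n))"
    using int by (subst nn_integral_suminf[OF meas]) simp
  also have "\<dots> = ennreal (\<Sum>n. \<rho> ^ n)"
    using \<rho> by (intro suminf_ennreal2) (auto intro: summable_geometric)
  finally have "(\<integral>\<^sup>+\<omega>. (\<Sum>n. ennreal (f n \<omega>)) \<partial>M) \<noteq> \<infinity>" by simp
  then have "AE \<omega> in M. (\<Sum>n. ennreal (f n \<omega>)) \<noteq> \<infinity>"
    by (intro nn_integral_PInf_AE borel_measurable_suminf_order) (use meas in auto)
  then have "AE \<omega> in M. eventually (\<lambda>n. \<epsilon> * real n \<le> (\<Sum>i<n. X i \<omega>)) sequentially"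
  proof eventually_elim
    case (elim \<omega>)
    have "summable (\<lambda>n. f n \<omega>)"
      by (rule summable_suminf_not_top) (use elim in \<open>simp_all add: f_def\<close>)
    then have "eventually (\<lambda>n. f n \<omega> < 1) sequentially"
      by (intro order_tendstoD(2)[OF summable_LIMSEQ_zero]) auto
    then show ?case by eventually_elim (simp add: f_def)
  qed
  then show ?thesis using \<epsilon> by blast
qed

lemma (in prob_space) exponential_AE_nonneg:
  assumes "0 < rate" "distributed M lborel X (exponential_density rate)"
  shows "AE \<omega> in M. 0 \<le> X \<omega>"
  by (subst distributed_AE2[OF assms(2)]) (auto simp: exponential_density_def)

lemma valid_rand_inst:
  assumes "\<And>j. order_list w (Os j \<omega>)" "\<And>j. 0 \<le> X j \<omega>"
  shows "valid_inst w (rand_inst Os X n \<omega>)"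
proof -
  have "sorted (map (\<lambda>j. \<Sum>i\<le>j. X i \<omega>) [0..<n])"
    using assms(2) by (auto simp: sorted_iff_nth_mono intro!: sum_mono2)
  moreover have "0 \<le> (\<Sum>i\<le>j. X i \<omega>)" for j using assms(2) by (simp add: sum_nonneg)
  ultimately show ?thesis
    using assms(1) by (auto simp: valid_inst_def rand_inst_def order_list_def comp_def)
qed

lemma last_rand_inst:
  assumes "0 < n"
  shows "rand_inst Os X n \<omega> \<noteq> []" "snd (last (rand_inst Os X n \<omega>)) = (\<Sum>i<n. X i \<omega>)"
proof -
  obtain m where "n = Suc m" using assms by (cases n) auto
  then show "rand_inst Os X n \<omega> \<noteq> []" "snd (last (rand_inst Os X n \<omega>)) = (\<Sum>i<n. X i \<omega>)"
    by (simp_all add: rand_inst_def lessThan_Suc_atMost)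
qed

text \<open>An additive error of order \<open>o(n)\<close> does not matter for quantities that grow linearly.\<close>

lemma ratio_tendsto_1:
  fixes a b q :: "nat \<Rightarrow> real"
  assumes "0 < \<epsilon>" "0 \<le> D" "q \<longlonglongrightarrow> 0"
    and "eventually (\<lambda>n. \<epsilon> * real n \<le> a n \<and> a n \<le> b n \<and> b n \<le> a n + D * (1 + q n * real n)) sequentially"
  shows "(\<lambda>n. b n / a n) \<longlonglongrightarrow> 1"
proof (rule tendsto_sandwich)
  have bounds: "eventually (\<lambda>n. 1 \<le> b n / a n \<and> b n / a n \<le> 1 + D / \<epsilon> * (1 / real n + q n)) sequentially"
    using assms(4) eventually_gt_at_top[of 0]
  proof eventually_elim
    case (elim n)
    have pos: "0 < \<epsilon> * real n" using assms(1) elim by simp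
    then have "0 < a n" using elim by linarith
    have "0 \<le> D * (1 + q n * real n)" using elim by linarith
    then have "D * (1 + q n * real n) / a n \<le> D * (1 + q n * real n) / (\<epsilon> * real n)"
      using elim pos by (intro divide_left_mono) auto
    also have "\<dots> = D / \<epsilon> * (1 / real n + q n)"
      using assms(1) elim by (simp add: field_simps)
    finally have "D * (1 + q n * real n) / a n \<le> D / \<epsilon> * (1 / real n + q n)" .
    moreover have "b n / a n \<le> (a n + D * (1 + q n * real n)) / a n"
      using elim \<open>0 < a n\<close> by (intro divide_right_mono) auto
    then have "b n / a n \<le> 1 + D * (1 + q n * real n) / a n"
      using \<open>0 < a n\<close> by (simp add: add_divide_distrib)
    ultimately show ?case using elim \<open>0 < a n\<close> by simp
  qed
  show "eventually (\<lambda>n. 1 \<le> b n / a n) sequentially"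
    using bounds by eventually_elim simp
  show "eventually (\<lambda>n. b n / a n \<le> 1 + D / \<epsilon> * (1 / real n + q n)) sequentially"
    using bounds by eventually_elim simp
  have "(\<lambda>n. 1 + D / \<epsilon> * (1 / real n + q n)) \<longlonglongrightarrow> 1 + D / \<epsilon> * (0 + 0)"
    by (intro tendsto_intros assms(3) lim_1_over_n)
  then show "(\<lambda>n. 1 + D / \<epsilon> * (1 / real n + q n)) \<longlonglongrightarrow> 1" by simp
qed simp

theorem theorem2:
  fixes sys :: system and w :: warehouse and rule :: "inst \<Rightarrow> state \<Rightarrow> plan"
    and M :: "'w measure" and Os :: "nat \<Rightarrow> 'w \<Rightarrow> point list" and X :: "nat \<Rightarrow> 'w \<Rightarrow> real"
    and rate :: real
  assumes "valid_warehouse w"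
    and "reopt_rule sys w rule"
    and "prob_space M"
    and "\<And>j \<omega>. \<omega> \<in> space M \<Longrightarrow> order_list w (Os j \<omega>)"
    and "prob_space.indep_vars M (\<lambda>_. order_space) Os UNIV"
    and "\<And>j. distr M order_space (Os j) = distr M order_space (Os 0)"
    and "0 < rate"
    and "\<And>j. distributed M lborel (X j) (exponential_density rate)"
    and "prob_space.indep_vars M (\<lambda>_. borel) X UNIV"
    and "prob_space.indep_set M
           (sets (vimage_algebra (space M) (\<lambda>\<omega> j. Os j \<omega>) (\<Pi>\<^sub>M j \<in> UNIV. order_space)))
           (sets (vimage_algebra (space M) (\<lambda>\<omega> j. X j \<omega>) (\<Pi>\<^sub>M j \<in> UNIV. borel)))"
    and "sys = Robot \<Longrightarrow> 1 < (\<integral>\<^sup>+\<omega>. of_nat (length (Os 0 \<omega>)) \<partial>M)"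
    and "AE \<omega> in M. (\<lambda>n. real (card (pending sys w rule (rand_inst Os X n \<omega>) (\<Sum>i<n. X i \<omega>))) / real n)
           \<longlonglongrightarrow> 0"
  shows "AE \<omega> in M. (\<lambda>n. reopt sys w rule (rand_inst Os X n \<omega>) / ciopt sys w (rand_inst Os X n \<omega>))
           \<longlonglongrightarrow> 1"
proof -
  interpret prob_space M by (rule assms(3))
  interpret picking w sys by unfold_locales (rule assms(1))
  obtain \<epsilon> where \<epsilon>: "0 < \<epsilon>"
    and linear: "AE \<omega> in M. eventually (\<lambda>n. \<epsilon> * real n \<le> (\<Sum>i<n. X i \<omega>)) sequentially"
    using exponential_partial_sums_linear[OF assms(7,8,9)] by blast
  have nonneg: "AE \<omega> in M. \<forall>j. 0 \<le> X j \<omega>"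
    using exponential_AE_nonneg[OF assms(7,8)] by (simp add: AE_all_countable)
  show ?thesis
    using linear nonneg assms(12) AE_space
  proof eventually_elim
    case (elim \<omega>)
    let ?I = "\<lambda>n. rand_inst Os X n \<omega>" and ?R = "\<lambda>n. \<Sum>i<n. X i \<omega>"
    let ?q = "\<lambda>n. real (card (pending sys w rule (?I n) (?R n))) / real n"
    show ?case
    proof (rule ratio_tendsto_1[OF \<epsilon> batch_bound_nonneg elim(3)])
      show "eventually (\<lambda>n. \<epsilon> * real n \<le> ciopt sys w (?I n) \<and>
          ciopt sys w (?I n) \<le> reopt sys w rule (?I n) \<and>
          reopt sys w rule (?I n) \<le> ciopt sys w (?I n) + batch_bound * (1 + ?q n * real n)) sequentially"
        using elim(1) eventually_gt_at_top[of 0]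
      proof eventually_elim
        case n: (elim n)
        have "valid_inst w (?I n)"
          by (rule valid_rand_inst) (use assms(4) elim(2,4) in auto)
        then interpret reopt_instance w sys "?I n" rule
          by unfold_locales (use assms(2) in auto)
        note last = last_rand_inst[OF n(2), of Os X \<omega>]
        show ?case
          using reopt_close_to_ciopt[OF last(1)] n unfolding last(2) by auto
      qed
    qed
  qed
qed

end
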